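(* Let $\mu$ be a positive real with $\sqrt{\mu}<\frac{1}{400}$. Let $G$ be an $n$-vertex graph of minimum degree at least $\frac{n}{2}$ and let $\mathcal{F}$ be a $\mu n$-bounded incompatibility system over $G$. Then at least one of the following holds: (i) there exists a Hamilton cycle in $G$ compatible with $\mathcal{F}$; (ii) there exist two sets $A,B\subseteq V(G)$ with $|A|,|B|\ge(\frac12-200\sqrt{\mu})n$ such that $e(A,B)\le 16\sqrt{\mu}\,n^2$.
   Context: All graphs are finite and simple. For sets of vertices $X,Y$, $e(X,Y)$ is the number of edges with one endpoint in $X$ and the other in $Y$, counted with multiplicity (so $e(X,X)$ is twice the number of edges inside $X$). An incompatibility system $\mathcal{F}$ over $G=(V,E)$ is a family $\{F_v\}_{v\in V}$ where each $F_v$ is a set of unordered pairs $\{e,e'\}$ of distinct edges with $e\cap e'=\{v\}$; edges $e,e'$ are incompatible if $\{e,e'\}\in F_v$ for some $v$, compatible otherwise. A cycle is compatible with $\mathcal{F}$ if every pair of its edges is compatible. For a positive real $\Delta$, $\mathcal{F}$ is $\Delta$-bounded if for every vertex $v$ and edge $e\ni v$, at most $\Delta$ other edges $e'\ni v$ satisfy $\{e,e'\}\in F_v$. *)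

theory Defs
  imports "HOL-Analysis.Analysis"
begin

definition simple_graph :: "'a set \<Rightarrow> 'a set set \<Rightarrow> bool" where
  "simple_graph V E \<longleftrightarrow> finite V \<and> (\<forall>e\<in>E. e \<subseteq> V \<and> card e = 2)"

definition degree :: "'a set set \<Rightarrow> 'a \<Rightarrow> nat" where
  "degree E v = card {e\<in>E. v \<in> e}"

text \<open>e(X,Y): number of ordered pairs (x,y), x in X, y in Y, with xy an edge
  (so edges inside X \<inter> Y are counted twice).\<close>
definition e_between :: "'a set set \<Rightarrow> 'a set \<Rightarrow> 'a set \<Rightarrow> nat" where
  "e_between E X Y = card {(x,y). x \<in> X \<and> y \<in> Y \<and> {x,y} \<in> E}"

definition incompatibility_system :: "'a set set \<Rightarrow> ('a \<Rightarrow> 'a set set set) \<Rightarrow> bool" where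
  "incompatibility_system E F \<longleftrightarrow>
     (\<forall>v. \<forall>p\<in>F v. \<exists>e e'. p = {e,e'} \<and> e \<in> E \<and> e' \<in> E \<and> e \<noteq> e' \<and> e \<inter> e' = {v})"

definition incompatible :: "('a \<Rightarrow> 'a set set set) \<Rightarrow> 'a set \<Rightarrow> 'a set \<Rightarrow> bool" where
  "incompatible F e e' \<longleftrightarrow> (\<exists>v. {e,e'} \<in> F v)"

definition bounded_system :: "'a set set \<Rightarrow> ('a \<Rightarrow> 'a set set set) \<Rightarrow> real \<Rightarrow> bool" where
  "bounded_system E F \<Delta> \<longleftrightarrow>
     (\<forall>v. \<forall>e\<in>E. v \<in> e \<longrightarrow> real (card {e'\<in>E. v \<in> e' \<and> e' \<noteq> e \<and> {e,e'} \<in> F v}) \<le> \<Delta>)"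

definition cycle_edges :: "'a list \<Rightarrow> 'a set set" where
  "cycle_edges cs = {{cs ! i, cs ! ((i + 1) mod length cs)} | i. i < length cs}"

definition hamilton_cycle :: "'a set \<Rightarrow> 'a set set \<Rightarrow> 'a list \<Rightarrow> bool" where
  "hamilton_cycle V E cs \<longleftrightarrow> length cs \<ge> 3 \<and> distinct cs \<and> set cs = V \<and> cycle_edges cs \<subseteq> E"

definition compatible_cycle :: "('a \<Rightarrow> 'a set set set) \<Rightarrow> 'a list \<Rightarrow> bool" where
  "compatible_cycle F cs \<longleftrightarrow>
     (\<forall>e\<in>cycle_edges cs. \<forall>e'\<in>cycle_edges cs. e \<noteq> e' \<longrightarrow> \<not> incompatible F e e')"

end

theory Submission
  imports Defs
begin

text \<open>
  Call an edge xy \<^emph>\<open>good\<close> for a path or cycle if it is compatible with the path edges at x and at y.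
  By boundedness at most 4 mu n^2 pairs are adjacent but not good, so all but 2 sqrt(mu) n vertices
  see few blocked neighbours.

  \<^item> A compatible path covering almost everything, both of whose ends see few blocked neighbours, can be closed
  to a compatible cycle on the same vertices by at most three good edges. With X the predecessors of the good
  neighbours of the first vertex and J the good neighbours of the last one, a path that does not close forces
  X and J to be nearly complementary, without good edges from X to the successors of J further along the path
  or to the predecessors of J before. Comparing degrees, X is then either almost an
  interval or almost free of consecutive positions, and both yield the sparse pair A, B.

  \<^item> A vertex v outside such a cycle can be absorbed: remove from the cycle two neighbours y, z of v, closing up
  each time, then attach the path z v y to the remaining cycle and close again.

  \<^item> Finally, induct on the number of incompatible transitions. Without any, this is Dirac's theorem. Otherwise drop
  one transition, centred at b say: the Hamilton cycle obtained by induction is compatible apart from b, so cutting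
  out b and the jammed vertices around it leaves a path to which the first two steps apply.
\<close>

section \<open>Positions on a path that cannot be closed\<close>

text \<open>G is the good-edge relation between positions of a path with ends 0 and N - 1. C0 excludes closing the path by a
  crossing pair of edges; C1 and C2 exclude doing so after rotating the end 0 to x, with k behind or before x.\<close>
lemma sparse_pair_if_not_closable:
  fixes G :: "nat \<Rightarrow> nat \<Rightarrow> bool" and N :: nat and h r :: real
  assumes sym: "\<And>i j. G i j \<Longrightarrow> G j i"
    and deg: "\<And>i. i < N \<Longrightarrow> i \<notin> Bd \<Longrightarrow> h \<le> real (card {j. j < N \<and> G i j})"
    and Bd: "finite Bd" "0 \<notin> Bd" "N - 1 \<notin> Bd" and N: "N \<ge> 6"
    and r: "r = real N - 2 * h"
    and C0: "\<And>x. 1 \<le> x \<Longrightarrow> x + 3 \<le> N \<Longrightarrow> G 0 (Suc x) \<Longrightarrow> \<not> G x (N - 1)"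
    and C1: "\<And>x k. 1 \<le> x \<Longrightarrow> x + 3 \<le> k \<Longrightarrow> k + 2 \<le> N \<Longrightarrow> G 0 (Suc x)
               \<Longrightarrow> G (k - 1) (N - 1) \<Longrightarrow> \<not> G k x"
    and C2: "\<And>x k. 1 \<le> k \<Longrightarrow> k + 2 \<le> x \<Longrightarrow> x + 3 \<le> N \<Longrightarrow> G 0 (Suc x)
               \<Longrightarrow> G (Suc k) (N - 1) \<Longrightarrow> \<not> G k x"
  shows "\<exists>A B. A \<subseteq> {..<N} \<and> B \<subseteq> {..<N}
           \<and> real (card A) \<ge> h - 7 * r - 70 - 4 * real (card Bd)
           \<and> real (card B) \<ge> h - 7 * r - 70 - 4 * real (card Bd)
           \<and> card {(x, y). x \<in> A \<and> y \<in> B \<and> G x y} \<le> 5 * N"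
proof -
  define X where "X = {x. G 0 (Suc x) \<and> 1 \<le> x \<and> x + 3 \<le> N}"
  define J where "J = {j. G j (N - 1) \<and> 2 \<le> j \<and> j + 3 \<le> N}"
  \<comment> \<open>The few leftover positions: |X| >= h - 3 and |J| >= h - 4 leave at most r + 7 of
    them.\<close>
  define L where "L = {..<N} - X - J"
  have fin: "finite X" "finite J" "finite L"
    by (auto simp: X_def J_def L_def intro: finite_subset[of _ "{..N}"])
  have sub: "X \<subseteq> {..<N}" "J \<subseteq> {..<N}" by (auto simp: X_def J_def)
  have disj: "X \<inter> J = {}" using C0 by (auto simp: X_def J_def)
  have tri: "y \<in> X \<or> y \<in> J \<or> y \<in> L" if "y < N" for y using that by (auto simp: L_def)
  have cardsum: "card X + card J + card L = N"
  proof -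
    have "{..<N} = X \<union> J \<union> L" using sub by (auto simp: L_def)
    moreover have "(X \<union> J) \<inter> L = {}" by (auto simp: L_def)
    ultimately have "N = card (X \<union> J) + card L"
      by (metis card_Un_disjoint card_lessThan fin finite_UnI)
    thus ?thesis using disj fin by (simp add: card_Un_disjoint)
  qed
  have cX: "real (card X) \<ge> h - 3"
  proof -
    have "{j. j < N \<and> G 0 j} \<subseteq> Suc ` X \<union> {0, 1, N - 1}"
    proof
      fix j assume j: "j \<in> {j. j < N \<and> G 0 j}"
      show "j \<in> Suc ` X \<union> {0, 1, N - 1}"
      proof (cases "2 \<le> j \<and> j + 2 \<le> N")
        case True
        then have "j = Suc (j - 1)" "j - 1 \<in> X" using j by (auto simp: X_def)
        then show ?thesis by blast
      next
        case False then show ?thesis using j by auto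
      qed
    qed
    then have "card {j. j < N \<and> G 0 j} \<le> card (Suc ` X \<union> {0, 1, N - 1})"
      using fin by (intro card_mono) auto
    also have "\<dots> \<le> card (Suc ` X) + card {0, 1, N - 1}" by (rule card_Un_le)
    also have "\<dots> \<le> card X + 3" using card_image_le[OF fin(1), of Suc] N
      by (intro add_mono) auto
    finally show ?thesis using deg[of 0] Bd N by linarith
  qed
  have cJ: "real (card J) \<ge> h - 4"
  proof -
    have "{j. j < N \<and> G (N - 1) j} \<subseteq> J \<union> {0, 1, N - 2, N - 1}"
      using sym by (auto simp: J_def)
    then have "card {j. j < N \<and> G (N - 1) j} \<le> card (J \<union> {0, 1, N - 2, N - 1})"
      using fin by (intro card_mono) auto
    also have "\<dots> \<le> card J + card {0, 1, N - 2, N - 1}" by (rule card_Un_le)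
    also have "\<dots> \<le> card J + 4" by (simp add: card_insert_if)
    finally show ?thesis using deg[of "N - 1"] Bd N by linarith
  qed
  have cL: "real (card L) \<le> r + 7" using cX cJ cardsum r by linarith
  have up: "\<not> G x y" if "x \<in> X" "y - 1 \<in> J" "x + 3 \<le> y" for x y
    using C1[of x y] that sym by (auto simp: X_def J_def)
  have down: "\<not> G x y" if "x \<in> X" "y + 1 \<in> J" "y + 2 \<le> x" for x y
    using C2[of y x] that sym by (auto simp: X_def J_def)
  have XN: "1 \<le> x \<and> x + 3 \<le> N" if "x \<in> X" for x using that by (auto simp: X_def)
  have JN: "2 \<le> x \<and> x + 3 \<le> N" if "x \<in> J" for x using that by (auto simp: J_def)
  \<comment> \<open>\<open>D\<close> and \<open>D'\<close> are the upper and the lower members of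
    the adjacent pairs in \<open>X\<close>. Their common size measures how far \<open>X\<close> is
    from being free of consecutive positions.\<close>
  define D where "D = {x\<in>X. x - 1 \<in> X}"
  define D' where "D' = {x\<in>X. x + 1 \<in> X}"
  have D_img: "D = Suc ` D'"
  proof
    show "D \<subseteq> Suc ` D'"
    proof
      fix x assume "x \<in> D"
      then have "x = Suc (x - 1)" "x - 1 \<in> D'" using XN[of "x - 1"] XN[of x] by (auto simp: D_def D'_def)
      then show "x \<in> Suc ` D'" by blast
    qed
  qed (auto simp: D_def D'_def)
  have cD: "card D = card D'" unfolding D_img by (rule card_image) simp
  have finD: "finite D" "finite D'" using fin by (auto simp: D_def D'_def)
  define U where "U = {x\<in>X - Bd. x + 1 \<in> J}"
  define U' where "U' = {x\<in>X - Bd. x - 1 \<in> J}"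
  \<comment> \<open>By C2, x in U has no neighbour in X above it, and by C1 only (nearly) successors of X there, hence nearly half
    of all vertices can only be reached if few successors of X lie in X again. U' is the mirror image.\<close>
  have cU: "real (card {z\<in>D'. x + 2 \<le> z}) \<le> 3 * r + 23" if x: "x \<in> U" for x
  proof -
    have xX: "x \<in> X" "x \<notin> Bd" "x + 1 \<in> J" using x by (auto simp: U_def)
    let ?P1 = "{z\<in>X. x + 2 \<le> z \<and> z \<notin> D'}" and ?P2 = "{z\<in>X. z < x}"
    have "{y. y < N \<and> G x y} \<subseteq> Suc ` ?P1 \<union> (\<lambda>z. z - 1) ` ?P2 \<union> Suc ` L \<union> (\<lambda>z. z - 1) ` L
            \<union> {x - 1, x, x + 1, x + 2}"
    proof
      fix y assume "y \<in> {y. y < N \<and> G x y}"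
      then have y: "y < N" "G x y" by auto
      consider "y \<ge> x + 3" | "y + 2 \<le> x" | "y \<in> {x - 1, x, x + 1, x + 2}" by fastforce
      then show "y \<in> Suc ` ?P1 \<union> (\<lambda>z. z - 1) ` ?P2 \<union> Suc ` L \<union> (\<lambda>z. z - 1) ` L
            \<union> {x - 1, x, x + 1, x + 2}"
      proof cases
        case 1
        have "y - 1 \<notin> J" using up xX y 1 by blast
        then have "y - 1 \<in> X \<or> y - 1 \<in> L" using tri[of "y - 1"] y by auto
        moreover have "y \<notin> X" using down[of y x] xX y 1 sym by auto
        moreover have "y = Suc (y - 1)" using 1 by auto
        ultimately have "y - 1 \<in> ?P1 \<or> y - 1 \<in> L" using 1 by (auto simp: D'_def)
        then show ?thesis using \<open>y = Suc (y - 1)\<close> by blast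
      next
        case 2
        have "y + 1 \<notin> J" using down xX y 2 by blast
        then have "y + 1 \<in> X \<or> y + 1 \<in> L" using tri[of "y + 1"] 2 XN[OF xX(1)] by auto
        then have "y + 1 \<in> ?P2 \<or> y + 1 \<in> L" using 2 by auto
        moreover have "y = (y + 1) - 1" by simp
        ultimately show ?thesis by blast
      qed auto
    qed
    then have "card {y. y < N \<and> G x y} \<le> card (Suc ` ?P1 \<union> (\<lambda>z. z - 1) ` ?P2 \<union> Suc ` L \<union> (\<lambda>z. z - 1) ` L
            \<union> {x - 1, x, x + 1, x + 2})"
      using fin by (intro card_mono) auto
    also have "\<dots> \<le> card (Suc ` ?P1) + card ((\<lambda>z. z - 1) ` ?P2) + card (Suc ` L) + card ((\<lambda>z. z - 1) ` L)
            + card {x - 1, x, x + 1, x + 2}"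
      by (intro order_trans[OF card_Un_le] add_mono order_refl)
    also have "\<dots> \<le> card ?P1 + card ?P2 + card L + card L + 4"
      using fin by (intro add_mono card_image_le) (auto simp: card_insert_if)
    also have "card ?P1 + card ?P2 = card (?P1 \<union> ?P2)"
      using fin by (intro card_Un_disjoint[symmetric]) auto
    also have "\<dots> \<le> card (X - {z\<in>D'. x + 2 \<le> z})"
      using fin by (intro card_mono) auto
    also have "\<dots> = card X - card {z\<in>D'. x + 2 \<le> z}"
      using fin by (intro card_Diff_subset) (auto simp: D'_def)
    finally have "card {y. y < N \<and> G x y} + card {z\<in>D'. x + 2 \<le> z} \<le> card X + card L + card L + 4"
      using card_mono[of X "{z\<in>D'. x + 2 \<le> z}"] fin by (force simp: D'_def)
    moreover have "h \<le> real (card {y. y < N \<and> G x y})" using deg[of x] xX sub by auto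
    ultimately show ?thesis using cL cJ cardsum r by linarith
  qed
  have cU': "real (card {z\<in>D'. z + 3 \<le> x}) \<le> 3 * r + 23" if x: "x \<in> U'" for x
  proof -
    have xX: "x \<in> X" "x \<notin> Bd" "x - 1 \<in> J" using x by (auto simp: U'_def)
    let ?Q = "{z\<in>D. z + 2 \<le> x}"
    let ?P1 = "{z\<in>X. z + 2 \<le> x \<and> z \<notin> D}" and ?P2 = "{z\<in>X. x < z}"
    let ?R = "(\<lambda>z. z - 1) ` ?P1 \<union> Suc ` ?P2 \<union> Suc ` L \<union> (\<lambda>z. z - 1) ` L
            \<union> {x - 2, x - 1, x, x + 1, x + 2}"
    have "{y. y < N \<and> G x y} \<subseteq> ?R"
    proof
      fix y assume "y \<in> {y. y < N \<and> G x y}"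
      then have y: "y < N" "G x y" by auto
      consider "y \<ge> x + 3" | "y + 3 \<le> x" | "y \<in> {x - 2, x - 1, x, x + 1, x + 2}" by fastforce
      then show "y \<in> ?R"
      proof cases
        case 1
        have "y - 1 \<notin> J" using up xX y 1 by blast
        then have "y - 1 \<in> X \<or> y - 1 \<in> L" using tri[of "y - 1"] y by auto
        moreover have "y = Suc (y - 1)" using 1 by auto
        ultimately have "y - 1 \<in> ?P2 \<or> y - 1 \<in> L" using 1 by auto
        then show ?thesis using \<open>y = Suc (y - 1)\<close> by blast
      next
        case 2
        have "y + 1 \<notin> J" using down[of x y] xX y 2 by auto
        then have "y + 1 \<in> X \<or> y + 1 \<in> L" using tri[of "y + 1"] 2 XN[OF xX(1)] by auto
        moreover have "y \<notin> X" using up[of y x] xX y 2 sym by auto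
        ultimately have "y + 1 \<in> ?P1 \<or> y + 1 \<in> L" using 2 by (auto simp: D_def)
        moreover have "y = (y + 1) - 1" by simp
        ultimately show ?thesis by blast
      qed auto
    qed
    then have "card {y. y < N \<and> G x y} \<le> card ?R"
      using fin by (intro card_mono) auto
    also have "\<dots> \<le> card ((\<lambda>z. z - 1) ` ?P1) + card (Suc ` ?P2) + card (Suc ` L) + card ((\<lambda>z. z - 1) ` L)
            + card {x - 2, x - 1, x, x + 1, x + 2}"
      by (intro order_trans[OF card_Un_le] add_mono order_refl)
    also have "\<dots> \<le> card ?P1 + card ?P2 + card L + card L + 5"
      using fin by (intro add_mono card_image_le) (auto simp: card_insert_if)
    also have "card ?P1 + card ?P2 = card (?P1 \<union> ?P2)"
      using fin by (intro card_Un_disjoint[symmetric]) auto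
    also have "\<dots> \<le> card (X - ?Q)"
      using fin by (intro card_mono) auto
    also have "\<dots> = card X - card ?Q"
      using fin by (intro card_Diff_subset) (auto simp: D_def)
    finally have "card {y. y < N \<and> G x y} + card ?Q \<le> card X + card L + card L + 5"
      using card_mono[of X ?Q] fin by (force simp: D_def)
    moreover have "?Q = Suc ` {z\<in>D'. z + 3 \<le> x}" unfolding D_img by auto
    then have "card ?Q = card {z\<in>D'. z + 3 \<le> x}" by (simp add: card_image)
    moreover have "h \<le> real (card {y. y < N \<and> G x y})" using deg[of x] xX sub by auto
    \<comment> \<open>Here |X| <= N - |J| <= h + r + 4 and |L| <= r + 7; the five positions near x
      bring the bound to 3r + 23. The argument for \<open>U\<close> has only four such
      positions.\<close>
    ultimately show ?thesis using cL cJ cardsum r by linarith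
  qed
  \<comment> \<open>A pair at distance at most 2 is encoded by x and the shifted offset y + 2 - x <
    5, which avoids negative differences.\<close>
  have few: "card {(x, y). x \<in> A \<and> y \<in> B \<and> G x y} \<le> 5 * N"
    if AB: "A \<subseteq> {..<N}" "B \<subseteq> {..<N}" and G: "\<And>x y. x \<in> A \<Longrightarrow> y \<in> B \<Longrightarrow> G x y \<Longrightarrow> y \<le> x + 2 \<and> x \<le> y + 2" for A B
  proof -
    have "{(x, y). x \<in> A \<and> y \<in> B \<and> G x y} \<subseteq> (\<lambda>(x, d). (x, x + d - 2)) ` ({..<N} \<times> {..<5})"
    proof clarify
      fix x y assume *: "x \<in> A" "y \<in> B" "G x y"
      have "(x, y) = (\<lambda>(x, d). (x, x + d - 2)) (x, y + 2 - x)" using G[OF *] by auto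
      moreover have "(x, y + 2 - x) \<in> {..<N} \<times> {..<5}" using G[OF *] * AB by auto
      ultimately show "(x, y) \<in> (\<lambda>(x, d). (x, x + d - 2)) ` ({..<N} \<times> {..<5::nat})" by blast
    qed
    then have "card {(x, y). x \<in> A \<and> y \<in> B \<and> G x y} \<le> card ({..<N} \<times> {..<5::nat})"
      by (intro surj_card_le) auto
    then show ?thesis by simp
  qed
  show ?thesis
  proof (cases "real (card D') \<le> 6 * r + 50")
    case True
    \<comment> \<open>Few consecutive positions: a surviving y has y - 1 outside both
      \<open>X\<close> and \<open>L\<close>, hence in \<open>J\<close> if y is at least x + 3, and
      then \<open>up\<close> forbids a good edge from x to y. As both sets are \<open>A\<close>,
      symmetry of G gives the other direction.\<close>
    define A where "A = X - D - Suc ` L"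
    have "card (X - (D \<union> Suc ` L)) \<ge> card X - card (D \<union> Suc ` L)" 
      by (intro diff_card_le_card_Diff) (use fin finD in auto)
    moreover have "card (D \<union> Suc ` L) \<le> card D + card L"
      by (metis card_Un_le card_image inj_Suc)
    moreover have "X - (D \<union> Suc ` L) = A" by (auto simp: A_def)
    ultimately have "card A + card D' + card L \<ge> card X" using cD by simp
    then have cA: "real (card A) \<ge> h - 7 * r - 70 - 4 * real (card Bd)"
      using True cX cL by linarith
    have low: "y \<le> x + 2" if "x \<in> A" "y \<in> A" "G x y" for x y
    proof (rule ccontr)
      assume "\<not> y \<le> x + 2"
      then have y: "x + 3 \<le> y" by simp
      have "y - 1 \<notin> X" using that by (auto simp: A_def D_def)
      moreover have "y - 1 \<notin> L"
      proof
        assume "y - 1 \<in> L"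
        then have "Suc (y - 1) \<in> Suc ` L" by blast
        moreover have "Suc (y - 1) = y" using y by simp
        ultimately show False using that by (simp add: A_def)
      qed
      moreover have "y - 1 < N" using that sub by (auto simp: A_def)
      ultimately have "y - 1 \<in> J" using tri by blast
      then show False using up[of x y] y that by (auto simp: A_def)
    qed
    have "A \<subseteq> {..<N}" using sub by (auto simp: A_def)
    with few[of A A] low sym cA show ?thesis by blast
  next
    case False
    \<comment> \<open>Otherwise the two bounds and a gap of four positions would give |D'| <= 2 (3r
      + 23) + 4 = 6r + 50, the threshold of the case distinction.\<close>
    have sep: "x' < x" if "x \<in> U" "x' \<in> U'" for x x'
    proof (rule ccontr)
      assume "\<not> x' < x"
      then have "D' \<subseteq> {z\<in>D'. x + 2 \<le> z} \<union> {z\<in>D'. z + 3 \<le> x'} \<union> {x' - 2 .. x + 1}" by auto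
      then have "card D' \<le> card ({z\<in>D'. x + 2 \<le> z} \<union> {z\<in>D'. z + 3 \<le> x'} \<union> {x' - 2 .. x + 1})"
        using finD by (intro card_mono) auto
      also have "\<dots> \<le> card {z\<in>D'. x + 2 \<le> z} + card {z\<in>D'. z + 3 \<le> x'} + card {x' - 2 .. x + 1}"
        by (intro order_trans[OF card_Un_le] add_mono order_refl)
      also have "card {x' - 2 .. x + 1} \<le> 4" using \<open>\<not> x' < x\<close> by auto
      finally have "card D' \<le> card {z\<in>D'. x + 2 \<le> z} + card {z\<in>D'. z + 3 \<le> x'} + 4" by simp
      then show False using False cU[OF that(1)] cU'[OF that(2)] by linarith
    qed
    have split: "card (X - D') \<le> 1 + 2 * card Bd + 2 * card L"
    proof -
      \<comment> \<open>Outside \<open>Bd\<close>, an element of \<open>X\<close> below m cannot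
        have its successor in \<open>J\<close>, and one above m cannot have its predecessor there.
        So \<open>X\<close> is almost a single interval around m.\<close>
      obtain m where m: "\<And>x. x \<in> U \<Longrightarrow> m \<le> x" "\<And>x. x \<in> U' \<Longrightarrow> x \<le> m"
      proof (cases "U = {}")
        case True
        have "x \<in> U' \<Longrightarrow> x \<le> N" for x using XN by (force simp: U'_def)
        with True that[of N] show ?thesis by blast
      next
        case False
        then have "(LEAST x. x \<in> U) \<in> U" by (meson LeastI_ex ex_in_conv)
        then have "x \<in> U' \<Longrightarrow> x \<le> (LEAST x. x \<in> U)" for x using sep less_imp_le by blast
        with that[of "LEAST x. x \<in> U"] show ?thesis by (simp add: Least_le)
      qed
      have lo: "card {x\<in>X - D'. x < m} \<le> card Bd + card L"
      proof -
        have "{x\<in>X - D'. x < m} \<subseteq> Bd \<union> (\<lambda>z. z - 1) ` L"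
        proof
          fix x assume x: "x \<in> {x\<in>X - D'. x < m}"
          then have "x \<notin> U" "x + 1 \<notin> X" using m(1) leD by (auto simp: D'_def)
          then have "x \<in> Bd \<or> x + 1 \<in> L" using x tri[of "x + 1"] XN[of x] by (auto simp: U_def)
          moreover have "x = (x + 1) - 1" by simp
          ultimately show "x \<in> Bd \<union> (\<lambda>z. z - 1) ` L" by blast
        qed
        then have "card {x\<in>X - D'. x < m} \<le> card (Bd \<union> (\<lambda>z. z - 1) ` L)"
          using fin Bd by (intro card_mono) auto
        also have "\<dots> \<le> card Bd + card L"
          by (intro order_trans[OF card_Un_le] add_mono order_refl card_image_le fin)
        finally show ?thesis .
      qed
      \<comment> \<open>Above m the predecessors are controlled, that is \<open>D\<close>; shifting
        down by one carries this over to \<open>D'\<close> and costs 1 for m itself.\<close>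
      have hi: "card {x\<in>X - D'. m \<le> x} \<le> 1 + card Bd + card L"
      proof -
        have "{x\<in>X. m < x \<and> x \<notin> D} \<subseteq> Bd \<union> Suc ` L"
        proof
          fix x assume x: "x \<in> {x\<in>X. m < x \<and> x \<notin> D}"
          then have "x \<notin> U'" "x - 1 \<notin> X" using m(2) leD by (auto simp: D_def)
          then have "x \<in> Bd \<or> x - 1 \<in> L" using x tri[of "x - 1"] XN[of x] by (fastforce simp: U'_def)
          moreover have "x = Suc (x - 1)" using x by simp
          ultimately show "x \<in> Bd \<union> Suc ` L" by blast
        qed
        then have "card {x\<in>X. m < x \<and> x \<notin> D} \<le> card (Bd \<union> Suc ` L)"
          using fin Bd by (intro card_mono) auto
        also have "\<dots> \<le> card Bd + card L"
          by (intro order_trans[OF card_Un_le] add_mono order_refl card_image_le fin)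
        finally have 1: "card {x\<in>X. m < x \<and> x \<notin> D} \<le> card Bd + card L" .
        have "{x\<in>X. m \<le> x} \<subseteq> insert m {x\<in>X. m < x}" by auto
        then have "card {x\<in>X. m \<le> x} \<le> card (insert m {x\<in>X. m < x})"
          using fin by (intro card_mono) auto
        also have "\<dots> \<le> 1 + card {x\<in>X. m < x}" using fin by (simp add: card_insert_if)
        finally have 2: "card {x\<in>X. m \<le> x} \<le> 1 + card {x\<in>X. m < x}" .
        have 3: "card {x\<in>X. m < x} = card {x\<in>X. m < x \<and> x \<notin> D} + card {x\<in>D. m < x}"
          using fin finD by (subst card_Un_disjoint[symmetric]) (auto simp: D_def intro!: arg_cong[where f = card])
        have 4: "card {x\<in>X. m \<le> x} = card {x\<in>X - D'. m \<le> x} + card {x\<in>D'. m \<le> x}"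
          using fin finD by (subst card_Un_disjoint[symmetric]) (auto simp: D'_def intro!: arg_cong[where f = card])
        have "{x\<in>D. m < x} = Suc ` {x\<in>D'. m \<le> x}" unfolding D_img by auto
        then have "card {x\<in>D. m < x} = card {x\<in>D'. m \<le> x}" by (simp add: card_image)
        with 1 2 3 4 show ?thesis by linarith
      qed
      have "X - D' = {x\<in>X - D'. x < m} \<union> {x\<in>X - D'. m \<le> x}" by auto
      then have "card (X - D') \<le> card {x\<in>X - D'. x < m} + card {x\<in>X - D'. m \<le> x}"
        by (metis card_Un_le)
      with lo hi show ?thesis by linarith
    qed
    have split': "card (X - D) \<le> 1 + 2 * card Bd + 2 * card L"
    proof -
      have "card (X - D) = card X - card D" "card (X - D') = card X - card D'"
        using finD by (intro card_Diff_subset; auto simp: D_def D'_def)+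
      then show ?thesis using cD split by simp
    qed
    \<comment> \<open>Both neighbours in \<open>J\<close> make \<open>up\<close> and
      \<open>down\<close> applicable to every y in \<open>B\<close>. Passing from \<open>J\<close>
      to \<open>B\<close> loses at most 2|L| + |X - D'| + |X - D| <= 6|L| + 4|Bd| + 2, the source of
      the term 4|Bd|.\<close>
    define B where "B = {y\<in>J. y - 1 \<in> J \<and> y + 1 \<in> J}"
    have "J \<subseteq> B \<union> Suc ` L \<union> Suc ` (X - D') \<union> (\<lambda>z. z - 1) ` L \<union> (\<lambda>z. z - 1) ` (X - D)"
    proof
      fix y assume y: "y \<in> J"
      have eq: "y = Suc (y - 1)" "y = (y + 1) - 1" using JN[OF y] by auto
      have "y \<notin> X" using y disj by auto
      have a: "y - 1 \<in> X - D' \<or> y - 1 \<in> J \<or> y - 1 \<in> L"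
        using tri[of "y - 1"] JN[OF y] \<open>y \<notin> X\<close> by (auto simp: D'_def)
      have b: "y + 1 \<in> X - D \<or> y + 1 \<in> J \<or> y + 1 \<in> L"
        using tri[of "y + 1"] JN[OF y] \<open>y \<notin> X\<close> by (auto simp: D_def)
      show "y \<in> B \<union> Suc ` L \<union> Suc ` (X - D') \<union> (\<lambda>z. z - 1) ` L \<union> (\<lambda>z. z - 1) ` (X - D)"
        using a b eq y unfolding B_def by blast
    qed
    then have "card J \<le> card (B \<union> Suc ` L \<union> Suc ` (X - D') \<union> (\<lambda>z. z - 1) ` L \<union> (\<lambda>z. z - 1) ` (X - D))"
      using fin by (intro card_mono) (auto simp: B_def)
    also have "\<dots> \<le> card B + card (Suc ` L) + card (Suc ` (X - D')) + card ((\<lambda>z. z - 1) ` L)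
        + card ((\<lambda>z. z - 1) ` (X - D))"
      by (intro order_trans[OF card_Un_le] add_mono order_refl)
    also have "\<dots> \<le> card B + card L + card (X - D') + card L + card (X - D)"
      using fin by (intro add_mono card_image_le) auto
    finally have cB: "real (card B) \<ge> h - 7 * r - 70 - 4 * real (card Bd)"
      using split split' cJ cL by linarith
    have cA: "real (card X) \<ge> h - 7 * r - 70 - 4 * real (card Bd)" using cX cL by linarith
    have "y \<le> x + 2 \<and> x \<le> y + 2" if "x \<in> X" "y \<in> B" "G x y" for x y
      using up[of x y] down[of x y] that unfolding B_def by (cases "x + 3 \<le> y"; cases "y + 2 \<le> x") auto
    moreover have "B \<subseteq> {..<N}" using sub by (auto simp: B_def)
    ultimately show ?thesis using few[of X B] sub cA cB by blast
  qed
qed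

section \<open>Compatible paths and cycles\<close>

fun consec :: "'a list \<Rightarrow> 'a set set" where
  "consec (a # b # xs) = insert {a, b} (consec (b # xs))"
| "consec _ = {}"

lemma consec_sub: "e \<in> consec xs \<Longrightarrow> e \<subseteq> set xs"
  by (induction xs rule: consec.induct) auto

lemma consec_Cons: "xs \<noteq> [] \<Longrightarrow> consec (x # xs) = insert {x, hd xs} (consec xs)"
  by (cases xs) auto

lemma consec_append:
  "xs \<noteq> [] \<Longrightarrow> ys \<noteq> [] \<Longrightarrow> consec (xs @ ys) = insert {last xs, hd ys} (consec xs \<union> consec ys)"
proof (induction xs rule: consec.induct)
  case ("2_2" v) then show ?case by (cases ys) auto
qed auto

lemma consec_append_sub: "consec xs \<subseteq> consec (xs @ ys)" "consec ys \<subseteq> consec (xs @ ys)"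
  by (cases "xs = []"; cases "ys = []"; auto simp: consec_append)+

lemma consec_rev: "consec (rev xs) = consec xs"
proof (induction xs rule: consec.induct)
  case (1 a b xs)
  have "consec (rev (a # b # xs)) = consec (rev (b # xs) @ [a])" by simp
  also have "\<dots> = insert {b, a} (consec (rev (b # xs)))"
    by (subst consec_append) auto
  finally show ?case using 1 by (simp add: insert_commute)
qed auto

text \<open>For empty \<open>us\<close> or \<open>vs\<close> the unspecified \<open>last\<close> or
  \<open>hd\<close> merely adds a spurious candidate; the point is that at most two remain.\<close>

lemma consec_nbrs:
  assumes "distinct (us @ y # vs)" "{y, z} \<in> consec (us @ y # vs)"
  shows "z \<in> {last us, hd vs}"
proof -
  have u: "{y, z} \<notin> consec us" "{y, z} \<notin> consec vs"
    using assms(1) consec_sub[of "{y, z}"] by auto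
  have v: "consec (y # vs) \<subseteq> insert {y, hd vs} (consec vs)" by (cases vs) auto
  have "consec (us @ y # vs) \<subseteq> insert {last us, y} (consec us \<union> consec (y # vs))"
    by (cases "us = []") (auto simp: consec_append)
  then have "{y, z} = {last us, y} \<or> {y, z} = {y, hd vs}" using assms(2) u v by auto
  then show ?thesis by (auto simp: doubleton_eq_iff)
qed

abbreviation cycle_consec :: "'a list \<Rightarrow> 'a set set" where
  "cycle_consec c \<equiv> consec (c @ [hd c])"

lemma cycle_consec_rotate1: "cycle_consec (rotate1 c) = cycle_consec c"
proof (cases c)
  case (Cons x c')
  show ?thesis
  proof (cases "c' = []")
    case False
    then have "consec ((c' @ [x]) @ [hd c']) = insert {x, hd c'} (consec (c' @ [x]))"
      by (subst consec_append) auto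
    moreover have "consec (x # c' @ [x]) = insert {x, hd c'} (consec (c' @ [x]))"
      using False by (cases c') auto
    ultimately show ?thesis using Cons False by simp
  qed (simp add: Cons)
qed simp

text \<open>The common feature of paths and cycles behind all counts of blocked pairs.\<close>

definition max_deg2 :: "'a set set \<Rightarrow> bool" where
  "max_deg2 M \<longleftrightarrow> (\<forall>y. finite {z. {y, z} \<in> M} \<and> card {z. {y, z} \<in> M} \<le> 2)"

lemma max_deg2I:
  assumes "\<And>y. \<exists>a b. \<forall>z. {y, z} \<in> M \<longrightarrow> z \<in> {a, b}"
  shows "max_deg2 M"
  unfolding max_deg2_def
proof
  fix y
  obtain a b where "{z. {y, z} \<in> M} \<subseteq> {a, b}" using assms[of y] by blast
  moreover have "card {a, b} \<le> 2" by (simp add: card_insert_if)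
  ultimately show "finite {z. {y, z} \<in> M} \<and> card {z. {y, z} \<in> M} \<le> 2"
    by (meson card_mono finite.emptyI finite.insertI finite_subset order_trans)
qed

lemma max_deg2_path: assumes "distinct p" shows "max_deg2 (consec p)"
proof (rule max_deg2I)
  fix y
  show "\<exists>a b. \<forall>z. {y, z} \<in> consec p \<longrightarrow> z \<in> {a, b}"
  proof (cases "y \<in> set p")
    case True
    then obtain us vs where "p = us @ y # vs" by (meson split_list)
    then have "\<forall>z. {y, z} \<in> consec p \<longrightarrow> z \<in> {last us, hd vs}"
      using assms consec_nbrs by metis
    then show ?thesis by blast
  next
    case False
    then have "{y, z} \<notin> consec p" for z using consec_sub[of "{y, z}" p] by auto
    then show ?thesis by blast
  qed
qed

text \<open>Rerouting may discard edges of \<open>M\<close> freely, but the new ones stay within k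
  vertices. Blocked sets then grow by at most k, which keeps chosen vertices usable through several
  reroutings.\<close>

definition near :: "nat \<Rightarrow> 'a set set \<Rightarrow> 'a set set \<Rightarrow> bool" where
  "near k M M' \<longleftrightarrow> (\<exists>S. finite S \<and> card S \<le> k \<and> (\<forall>e\<in>M'. e \<in> M \<or> e \<subseteq> S))"

text \<open>\<open>bad a b c\<close> forbids passing from edge ab to edge bc at b. With a predicate
  on triples, the final induction can delete a single transition.\<close>

locale transition_system =
  fixes V :: "'a set" and adj :: "'a \<Rightarrow> 'a \<Rightarrow> bool" and bad :: "'a \<Rightarrow> 'a \<Rightarrow> 'a \<Rightarrow> bool" and d :: real
  assumes fin_V: "finite V"
    and adj_sym: "adj x y \<Longrightarrow> adj y x"
    and adj_irrefl: "\<not> adj x x"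
    and adj_V: "adj x y \<Longrightarrow> x \<in> V"
    and bad_sym: "bad a b c \<Longrightarrow> bad c b a"
    and bad_adj: "bad a b c \<Longrightarrow> adj a b"
    and bad_bound: "real (card {c. bad a b c}) \<le> d"
begin

lemma adj_V2: "adj x y \<Longrightarrow> y \<in> V" using adj_V adj_sym by blast

lemma bad_V: "bad a b c \<Longrightarrow> a \<in> V \<and> b \<in> V \<and> c \<in> V"
  using bad_adj bad_sym adj_V adj_V2 by meson

fun walk :: "'a list \<Rightarrow> bool" where
  "walk (a # b # c # xs) \<longleftrightarrow> adj a b \<and> \<not> bad a b c \<and> walk (b # c # xs)"
| "walk [a, b] \<longleftrightarrow> adj a b"
| "walk _ \<longleftrightarrow> True"

lemma walk_snoc: "walk (xs @ [a, b, c]) \<longleftrightarrow> walk (xs @ [a, b]) \<and> adj b c \<and> \<not> bad a b c"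
  by (induction xs rule: walk.induct) auto

lemma walk_rev: "walk (rev xs) \<longleftrightarrow> walk xs"
proof (induction xs rule: walk.induct)
  case (1 a b c xs)
  have "walk (rev (a # b # c # xs)) = walk (rev xs @ [c, b, a])" by simp
  also have "\<dots> \<longleftrightarrow> walk (rev (b # c # xs)) \<and> adj b a \<and> \<not> bad c b a"
    unfolding walk_snoc by simp
  finally show ?case using 1 adj_sym bad_sym by auto
qed (use adj_sym in auto)

lemma walk_Cons: "walk (x # xs) \<Longrightarrow> walk xs"
  by (cases xs rule: walk.cases) (auto)

lemma walk_append2: "walk (xs @ ys) \<Longrightarrow> walk ys"
  by (induction xs) (auto dest: walk_Cons)

lemma walk_append1: "walk (xs @ ys) \<Longrightarrow> walk xs"
  by (metis rev_append walk_append2 walk_rev)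

lemma walk_join:
  assumes "walk (xs @ [a, b])" "walk (c # e # ys)" "adj b c" "\<not> bad a b c" "\<not> bad b c e"
  shows "walk (xs @ [a, b] @ c # e # ys)"
  using assms(1)
proof (induction xs)
  case Nil then show ?case using assms by simp
next
  case (Cons x xs)
  have IH: "walk (xs @ [a, b] @ c # e # ys)" using Cons walk_Cons by fastforce
  show ?case
  proof (cases xs)
    case Nil then show ?thesis using IH Cons.prems by simp
  next
    case (Cons y zs) then show ?thesis using IH Cons.prems by (cases zs) auto
  qed
qed

text \<open>Conflicts with all \<open>M\<close>-edges at x and y are excluded, so the new edge stays
  compatible whichever of them a rerouting keeps.\<close>

definition good_edge :: "'a set set \<Rightarrow> 'a \<Rightarrow> 'a \<Rightarrow> bool" where
  "good_edge M x y \<longleftrightarrow> adj x y \<and> (\<forall>z. {y, z} \<in> M \<longrightarrow> \<not> bad x y z) \<and> (\<forall>z. {x, z} \<in> M \<longrightarrow> \<not> bad y x z)"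

lemma good_edge_sym: "good_edge M x y \<Longrightarrow> good_edge M y x"
  using adj_sym by (auto simp: good_edge_def)

section \<open>Joining segments by good edges\<close>

lemma length2_split: assumes "length xs \<ge> 2" shows "\<exists>us a b. xs = us @ [a, b]"
proof -
  obtain ys b where ys: "xs = ys @ [b]" using assms by (cases xs rule: rev_cases) auto
  moreover obtain us a where "ys = us @ [a]" using assms ys by (cases ys rule: rev_cases) auto
  ultimately show ?thesis by simp
qed

text \<open>With at least two vertices on each side, both transitions at the joint consist of the
  new edge and an edge of \<open>M\<close>. The tail \<open>zs\<close> lets chains of segments be
  built from the back.\<close>

lemma walk_append_good:
  assumes "walk xs" "walk (ys @ zs)" "length xs \<ge> 2" "length ys \<ge> 2"
    "consec xs \<subseteq> M" "consec ys \<subseteq> M" "good_edge M (last xs) (hd ys)"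
  shows "walk (xs @ ys @ zs)"
proof -
  obtain us a b where xs: "xs = us @ [a, b]" using length2_split assms(3) by blast
  obtain c e vs where ys: "ys = c # e # vs" using assms(4)
    by (metis Suc_le_length_iff numeral_2_eq_2)
  have "{a, b} \<in> M" using assms(5) xs consec_append_sub(2)[of "[a, b]" us] by auto
  moreover have "{c, e} \<in> M" using assms(6) ys by auto
  ultimately have "adj b c" "\<not> bad a b c" "\<not> bad b c e"
    using assms(7) bad_sym unfolding good_edge_def xs ys by (auto simp: insert_commute)
  then show ?thesis using walk_join[of us a b c e "vs @ zs"] assms(1,2) xs ys by simp
qed

definition cpath :: "'a list \<Rightarrow> bool" where
  "cpath p \<longleftrightarrow> distinct p \<and> set p \<subseteq> V \<and> walk p"

text \<open>Repeating the first two vertices makes \<open>walk\<close> test the closing edge and the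
  transitions at both of its ends.\<close>

definition ccycle :: "'a list \<Rightarrow> bool" where
  "ccycle c \<longleftrightarrow> distinct c \<and> set c \<subseteq> V \<and> 3 \<le> length c \<and> walk (c @ take 2 c)"

lemma ccycle_cpath: "ccycle c \<Longrightarrow> cpath c"
  using walk_append1 by (auto simp: ccycle_def cpath_def)

lemma ccycle_rotate1: assumes "ccycle c" shows "ccycle (rotate1 c)"
proof -
  obtain x y z w where c: "c = x # y # z # w" using assms
    by (metis ccycle_def Suc_le_length_iff numeral_3_eq_3)
  have "walk (x # (y # z # w) @ [x, y])" using assms c by (simp add: ccycle_def)
  then have "walk ((y # z # w) @ [x, y])" "adj y z" "\<not> bad x y z"
    using walk_Cons by (fastforce, (cases w; auto)+)
  then have "walk ((y # z # w) @ [x, y, z])" unfolding walk_snoc by simp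
  then show ?thesis using assms c by (auto simp: ccycle_def)
qed

lemma ccycle_hd:
  assumes "ccycle c" "y \<in> set c"
  obtains q where "ccycle (y # q)" "set (y # q) = set c" "cycle_consec (y # q) = cycle_consec c"
proof -
  obtain us vs where uv: "c = us @ y # vs" using assms(2) by (meson split_list)
  have "ccycle (rotate k c) \<and> cycle_consec (rotate k c) = cycle_consec c" for k
    by (induction k) (use assms ccycle_rotate1 cycle_consec_rotate1 in \<open>auto simp: rotate_def\<close>)
  moreover have "rotate (length us) c = y # vs @ us" unfolding uv by (simp add: rotate_append)
  ultimately have "ccycle (y # (vs @ us))" "cycle_consec (y # (vs @ us)) = cycle_consec c"
    by metis+
  moreover have "set (y # (vs @ us)) = set c" using uv by auto
  ultimately show ?thesis using that by blast
qed

lemma max_deg2_cycle: assumes "ccycle c" shows "max_deg2 (cycle_consec c)"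
proof (rule max_deg2I)
  fix y
  show "\<exists>a b. \<forall>z. {y, z} \<in> cycle_consec c \<longrightarrow> z \<in> {a, b}"
  proof (cases "y \<in> set c")
    case True
    then obtain q where q: "ccycle (y # q)" "cycle_consec (y # q) = cycle_consec c"
      using ccycle_hd assms by metis
    then have "q \<noteq> []" "y \<notin> set q" by (auto simp: ccycle_def)
    then have e1: "consec (y # q @ [y]) = {{y, hd q}, {last q, y}} \<union> consec q"
      by (simp add: consec_Cons consec_append insert_commute)
    have e2: "{y, z} \<notin> consec q" for z
      using \<open>y \<notin> set q\<close> consec_sub[of "{y, z}" q] by auto
    have e3: "cycle_consec c = consec (y # q @ [y])" using q(2) by simp
    have "{y, z} = {y, hd q} \<or> {y, z} = {last q, y}" if a: "{y, z} \<in> cycle_consec c" for z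
    proof -
      have "{y, z} \<in> {{y, hd q}, {last q, y}} \<union> consec q" using a unfolding e3 e1 .
      with e2[of z] show ?thesis by (simp only: Un_iff insert_iff empty_iff simp_thms)
    qed
    then have "{y, z} \<in> cycle_consec c \<Longrightarrow> z \<in> {hd q, last q}" for z
      by (fastforce simp: doubleton_eq_iff)
    then show ?thesis by blast
  next
    case False
    have "c \<noteq> []" using assms by (auto simp: ccycle_def)
    then have "{y, z} \<notin> cycle_consec c" for z using False consec_sub[of "{y, z}" "c @ [hd c]"] by auto
    then show ?thesis by blast
  qed
qed

text \<open>The new edges join segment ends, four vertices here and six with three segments; 6
  serves as the common bound.\<close>

lemma ccycle_two_segments:
  assumes "distinct (A @ B)" "set (A @ B) \<subseteq> V" "length A \<ge> 2" "length B \<ge> 2"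
    "walk A" "walk B" "consec A \<subseteq> M" "consec B \<subseteq> M"
    "good_edge M (last A) (hd B)" "good_edge M (last B) (hd A)"
  shows "ccycle (A @ B) \<and> near 6 M (cycle_consec (A @ B))"
proof -
  \<comment> \<open>Appending the first two vertices of \<open>A\<close> to \<open>B\<close> treats
    the closing joint like the other one.\<close>
  obtain a a' As where A: "A = a # a' # As" using assms(3) by (metis Suc_le_length_iff numeral_2_eq_2)
  have ne: "B \<noteq> []" using assms(4) by auto
  have "consec [a, a'] \<subseteq> M" "walk ([a, a'] @ [])" using assms A by (auto dest: walk_append1[of "[a, a']", simplified])
  then have "walk (B @ [a, a'] @ [])" 
    using assms A by (intro walk_append_good[of B "[a, a']" "[]" M]) auto
  then have "walk (A @ B @ [a, a'])" using assms by (intro walk_append_good[of A B "[a, a']" M]) auto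
  then have 1: "ccycle (A @ B)" using assms A by (auto simp: ccycle_def)
  have "consec (A @ B @ [hd A]) = insert {last A, hd B} (consec A \<union> insert {last B, hd A} (consec B))"
    using ne A by (subst consec_append, simp, simp, subst consec_append) auto
  moreover have "card {last A, hd B, last B, hd A} \<le> 6" using card_length[of "[last A, hd B, last B, hd A]"] by simp
  ultimately have "near 6 M (cycle_consec (A @ B))"
    unfolding near_def using assms(7-8) A
    by (intro exI[of _ "{last A, hd B, last B, hd A}"] conjI) auto
  then show ?thesis using 1 by blast
qed

lemma ccycle_three_segments:
  assumes "distinct (A @ B @ C)" "set (A @ B @ C) \<subseteq> V" "length A \<ge> 2" "length B \<ge> 2" "length C \<ge> 2"
    "walk A" "walk B" "walk C" "consec A \<subseteq> M" "consec B \<subseteq> M" "consec C \<subseteq> M"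
    "good_edge M (last A) (hd B)" "good_edge M (last B) (hd C)" "good_edge M (last C) (hd A)"
  shows "ccycle (A @ B @ C) \<and> near 6 M (cycle_consec (A @ B @ C))"
proof -
  obtain a a' As where A: "A = a # a' # As" using assms(3) by (metis Suc_le_length_iff numeral_2_eq_2)
  have ne: "B \<noteq> []" "C \<noteq> []" using assms(4,5) by auto
  have "consec [a, a'] \<subseteq> M" "walk ([a, a'] @ [])" using assms A by (auto dest: walk_append1[of "[a, a']", simplified])
  then have "walk (C @ [a, a'] @ [])" 
    using assms A by (intro walk_append_good[of C "[a, a']" "[]" M]) auto
  then have "walk (B @ C @ [a, a'])" using assms by (intro walk_append_good[of B C "[a, a']" M]) auto
  then have "walk (A @ B @ C @ [a, a'])" using assms by (intro walk_append_good[of A B "C @ [a, a']" M]) auto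
  then have 1: "ccycle (A @ B @ C)" using assms A by (auto simp: ccycle_def)
  have "consec (A @ B @ C @ [hd A])
      = insert {last A, hd B} (consec A \<union> insert {last B, hd C} (consec B \<union> insert {last C, hd A} (consec C)))"
    using ne A by (subst consec_append, simp, simp, subst consec_append, simp, simp, subst consec_append) auto
  moreover have "card {last A, hd B, last B, hd C, last C, hd A} \<le> 6" using card_length[of "[last A, hd B, last B, hd C, last C, hd A]"] by simp
  ultimately have "near 6 M (cycle_consec (A @ B @ C))"
    unfolding near_def using assms(7-11) A
    by (intro exI[of _ "{last A, hd B, last B, hd C, last C, hd A}"] conjI) auto
  then show ?thesis using 1 by blast
qed

section \<open>Counting blocked neighbours\<close>

definition blocked :: "'a set set \<Rightarrow> 'a \<Rightarrow> 'a set" where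
  "blocked M x = {y. \<exists>z. {y, z} \<in> M \<and> bad x y z}"

lemma blocked_sub: "blocked M x \<subseteq> V"
  using bad_V by (auto simp: blocked_def)

lemma blocked_mono: "M \<subseteq> M' \<Longrightarrow> blocked M x \<subseteq> blocked M' x"
  by (auto simp: blocked_def)

lemma finite_blocked: "finite (blocked M x)"
  using blocked_sub fin_V finite_subset by blast

lemma finite_bad: "finite {c. bad a b c}" "finite {c. bad c b a}"
proof -
  have "{c. bad a b c} \<subseteq> V" "{c. bad c b a} \<subseteq> V" using bad_V by blast+
  then show "finite {c. bad a b c}" "finite {c. bad c b a}" using fin_V finite_subset by blast+
qed

lemma bad_bound2: "real (card {c. bad c b a}) \<le> d"
  using bad_bound[of a b] bad_sym by (metis (no_types, lifting) Collect_cong)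

text \<open>A newly blocked y lies on a new edge, hence in the set S of at most k vertices.\<close>

lemma card_blocked_near:
  assumes "near k M M'"
  shows "card (blocked M' x) \<le> card (blocked M x) + k"
proof -
  obtain S where S: "finite S" "card S \<le> k" "\<And>e. e \<in> M' \<Longrightarrow> e \<in> M \<or> e \<subseteq> S"
    using assms by (auto simp: near_def)
  have "blocked M' x \<subseteq> blocked M x \<union> S"
    using S(3) by (fastforce simp: blocked_def)
  then have "card (blocked M' x) \<le> card (blocked M x \<union> S)"
    using S finite_blocked by (intro card_mono) auto
  also have "\<dots> \<le> card (blocked M x) + card S" by (rule card_Un_le)
  finally show ?thesis using S(2) by simp
qed

text \<open>At most two edges of \<open>M\<close> meet y, and each conflicts there with at most d
  others. Unlike the size of \<open>blocked\<close>, which records conflicts at the far end, this is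
  small at every vertex.\<close>

lemma card_blocked_at:
  assumes "max_deg2 M" shows "real (card {x. \<exists>z. {y, z} \<in> M \<and> bad x y z}) \<le> 2 * d"
proof -
  have d0: "d \<ge> 0" using bad_bound[of undefined undefined] by (meson of_nat_0_le_iff order_trans)
  have f: "finite {z. {y, z} \<in> M}" "card {z. {y, z} \<in> M} \<le> 2" using assms by (auto simp: max_deg2_def)
  have "{x. \<exists>z. {y, z} \<in> M \<and> bad x y z} = (\<Union>z\<in>{z. {y, z} \<in> M}. {x. bad x y z})" by auto
  then have "card {x. \<exists>z. {y, z} \<in> M \<and> bad x y z} \<le> (\<Sum>z\<in>{z. {y, z} \<in> M}. card {x. bad x y z})"
    using card_UN_le[OF f(1)] by simp
  then have "real (card {x. \<exists>z. {y, z} \<in> M \<and> bad x y z}) \<le> (\<Sum>z\<in>{z. {y, z} \<in> M}. real (card {x. bad x y z}))"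
    by (simp only: of_nat_sum[symmetric] of_nat_le_iff)
  also have "\<dots> \<le> of_nat (card {z. {y, z} \<in> M}) * d"
    by (rule sum_bounded_above) (simp add: bad_bound2)
  also have "\<dots> \<le> 2 * d" using f d0 by (intro mult_right_mono) auto
  finally show ?thesis .
qed

text \<open>Double counting: a blocked pair (x, y) is a conflict at y, and
  \<open>card_blocked_at\<close> allows each y at most 2d of them.\<close>

lemma sum_blocked:
  assumes "max_deg2 M"
  shows "(\<Sum>x\<in>V. real (card (blocked M x))) \<le> 2 * d * real (card V)"
proof -
  have "(\<Sum>x\<in>V. real (card (blocked M x))) = real (card (SIGMA x:V. blocked M x))"
    using fin_V finite_blocked by (simp add: card_SigmaI)
  also have "(SIGMA x:V. blocked M x) = (SIGMA y:V. {x. \<exists>z. {y, z} \<in> M \<and> bad x y z})\<inverse>"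
    unfolding blocked_def using bad_V by blast
  also have "card \<dots> = card (SIGMA y:V. {x. \<exists>z. {y, z} \<in> M \<and> bad x y z})"
    by (rule card_inverse)
  also have "real \<dots> = (\<Sum>y\<in>V. real (card {x. \<exists>z. {y, z} \<in> M \<and> bad x y z}))"
  proof -
    have "finite {x. \<exists>z. {y, z} \<in> M \<and> bad x y z}" for y
      by (rule finite_subset[OF _ fin_V]) (use bad_V in blast)
    then show ?thesis using fin_V by (simp add: card_SigmaI)
  qed
  also have "\<dots> \<le> of_nat (card V) * (2 * d)"
    by (rule sum_bounded_above) (simp add: card_blocked_at assms)
  finally show ?thesis by (simp add: mult.commute mult.left_commute)
qed

text \<open>Markov's inequality for \<open>sum_blocked\<close>.\<close>

lemma card_many_blocked:
  assumes "max_deg2 M" "t > 0"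
  shows "t * real (card {x\<in>V. real (card (blocked M x)) > t}) \<le> 2 * d * real (card V)"
proof -
  have "real (card {x\<in>V. real (card (blocked M x)) > t}) * t \<le> (\<Sum>x\<in>{x\<in>V. real (card (blocked M x)) > t}. real (card (blocked M x)))"
    by (rule sum_bounded_below) auto
  also have "\<dots> \<le> (\<Sum>x\<in>V. real (card (blocked M x)))"
    using fin_V by (intro sum_mono2) auto
  also have "\<dots> \<le> 2 * d * real (card V)" by (rule sum_blocked[OF assms(1)])
  finally show ?thesis by (simp add: mult.commute)
qed

section \<open>Dirac's theorem for systems without bad transitions\<close>

lemma walk_ConsI:
  assumes "walk xs" "xs \<noteq> [] \<Longrightarrow> adj x (hd xs)" "tl xs \<noteq> [] \<Longrightarrow> \<not> bad x (hd xs) (hd (tl xs))"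
  shows "walk (x # xs)"
  using assms by (cases xs rule: walk.cases) auto

lemma walk_append_no_bad:
  assumes nb: "\<And>a b c. \<not> bad a b c"
  shows "walk xs \<Longrightarrow> walk ys \<Longrightarrow> xs \<noteq> [] \<Longrightarrow> ys \<noteq> [] \<Longrightarrow> adj (last xs) (hd ys) \<Longrightarrow> walk (xs @ ys)"
proof (induction xs)
  case (Cons x xs)
  show ?case
  proof (cases "xs = []")
    case True
    then show ?thesis using Cons.prems by (simp add: walk_ConsI[OF _ _ nb])
  next
    case False
    then have "walk (xs @ ys)" using Cons walk_Cons by auto
    moreover have "adj x (hd xs)" using Cons.prems(1) False by (cases xs rule: walk.cases) auto
    ultimately show ?thesis using False by (simp add: walk_ConsI[OF _ _ nb])
  qed
qed simp

text \<open>The base of the induction. On a longest path all neighbours of the ends lie on the path;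
  a crossing pair of end neighbours closes it to a cycle, and a vertex outside would yield a longer
  path.\<close>

theorem dirac:
  assumes nb: "\<And>a b c. \<not> bad a b c" and n3: "card V \<ge> 3"
    and mindeg: "\<And>x. x \<in> V \<Longrightarrow> real (card V) / 2 \<le> real (card {y. adj x y})"
  shows "\<exists>c. ccycle c \<and> set c = V"
proof -
  have len: "length p \<le> card V" if "cpath p" for p
    using that fin_V by (metis card_mono cpath_def distinct_card)
  obtain p where p: "cpath p" and max: "\<And>q. cpath q \<Longrightarrow> length q \<le> length p"
  proof -
    have "cpath []" by (simp add: cpath_def)
    then show ?thesis using that ex_has_greatest_nat[of cpath "[]" length "Suc (card V)"] len
      by (meson le_imp_less_Suc)
  qed
  define N where "N = length p"
  have dist: "distinct p" and pV: "set p \<subseteq> V" and wp: "walk p" using p by (auto simp: cpath_def)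
  have "V \<noteq> {}" using n3 by auto
  then obtain v0 where "v0 \<in> V" by blast
  then have "cpath [v0]" by (simp add: cpath_def)
  then have ne: "p \<noteq> []" using max[of "[v0]"] by auto
  have hl: "hd p = p ! 0" "last p = p ! (N - 1)" using ne by (auto simp: N_def hd_conv_nth last_conv_nth)
  have ext1: "y \<in> set p" if "adj (hd p) y" for y
  proof (rule ccontr)
    assume "y \<notin> set p"
    moreover have "walk ([y] @ p)" using that adj_sym ne wp by (intro walk_append_no_bad nb) auto
    ultimately have "cpath (y # p)" using dist pV that adj_V2 by (auto simp: cpath_def)
    then show False using max by force
  qed
  have ext2: "y \<in> set p" if "adj (last p) y" for y
  proof (rule ccontr)
    assume "y \<notin> set p"
    moreover have "walk (p @ [y])" using that ne wp by (intro walk_append_no_bad nb) auto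
    ultimately have "cpath (p @ [y])" using dist pV that adj_V2 by (auto simp: cpath_def)
    then show False using max by force
  qed
  have hV: "hd p \<in> V" "last p \<in> V" using ne pV by auto
  define I where "I = {i. Suc i < N \<and> adj (p ! 0) (p ! Suc i)}"
  define J where "J = {i. Suc i < N \<and> adj (p ! (N - 1)) (p ! i)}"
  have fin: "finite I" "finite J" by (auto simp: I_def J_def intro: finite_subset[of _ "{..<N}"])
  have cI: "card {y. adj (hd p) y} \<le> card I"
  proof (rule surj_card_le[OF fin(1), of _ "\<lambda>i. p ! Suc i"], rule subsetI)
    fix y assume "y \<in> {y. adj (hd p) y}"
    then have a: "adj (hd p) y" by simp
    then obtain j where j: "j < N" "y = p ! j" using ext1 by (metis N_def in_set_conv_nth)
    then have "j \<noteq> 0" using a adj_irrefl hl by metis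
    then obtain i where "j = Suc i" using not0_implies_Suc by blast
    then show "y \<in> (\<lambda>i. p ! Suc i) ` I" using a j hl by (auto simp: I_def)
  qed
  have cJ: "card {y. adj (last p) y} \<le> card J"
  proof (rule surj_card_le[OF fin(2), of _ "\<lambda>i. p ! i"], rule subsetI)
    fix y assume "y \<in> {y. adj (last p) y}"
    then have a: "adj (last p) y" by simp
    then obtain j where j: "j < N" "y = p ! j" using ext2 by (metis N_def in_set_conv_nth)
    then have "j \<noteq> N - 1" using a adj_irrefl hl by metis
    then have "j \<in> J" using a j hl by (auto simp: J_def)
    then show "y \<in> (!) p ` J" using j by blast
  qed
  have IN: "I \<subseteq> {..<N - 1}" "J \<subseteq> {..<N - 1}" by (auto simp: I_def J_def)
  have cIN: "card I \<le> N - 1" using card_mono[OF _ IN(1)] by simp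
  have big: "real (card V) / 2 \<le> real (card I)" "real (card V) / 2 \<le> real (card J)"
    using cI cJ mindeg[OF hV(1)] mindeg[OF hV(2)] by linarith+
  have NV: "N \<le> card V" using len[OF p] by (simp add: N_def)
  have N1: "N \<ge> 1" using ne by (cases p) (auto simp: N_def)
  \<comment> \<open>Both sets live in N - 1 positions, and each has at least |V|/2 >= N/2
    elements.\<close>
  have "I \<inter> J \<noteq> {}"
  proof
    assume "I \<inter> J = {}"
    then have "card I + card J = card (I \<union> J)" using fin by (simp add: card_Un_disjoint)
    also have "\<dots> \<le> card {..<N - 1}" using IN by (intro card_mono) auto
    finally have "card I + card J \<le> N - 1" by simp
    then show False using big NV N1 by linarith
  qed
  then obtain i where i: "Suc i < N" "adj (p ! 0) (p ! Suc i)" "adj (p ! (N - 1)) (p ! i)"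
    by (auto simp: I_def J_def)
  define xs ys where "xs = take (Suc i) p" and "ys = drop (Suc i) p"
  have eq: "p = xs @ ys" by (simp add: xs_def ys_def)
  have lens: "length xs = Suc i" "length ys = N - Suc i" using i by (auto simp: xs_def ys_def N_def)
  have nes: "xs \<noteq> []" "ys \<noteq> []" using lens i by auto
  have v: "hd xs = p ! 0" "last xs = p ! i" "hd ys = p ! Suc i" "last ys = p ! (N - 1)"
    using nes lens i by (auto simp: eq nth_append hd_conv_nth last_conv_nth)
  define c where "c = xs @ rev ys"
  have wc: "walk c" unfolding c_def
    using walk_append1[of xs ys] walk_append2[of xs ys] eq wp nes v i adj_sym
    by (intro walk_append_no_bad nb) (auto simp: walk_rev hd_rev)
  have setc: "set c = set p" using eq by (simp add: c_def)
  have dc: "distinct c" using dist eq by (simp add: c_def)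
  have lc: "length c = N" using eq by (simp add: c_def N_def)
  have adjc: "adj (last c) (hd c)" using nes v i adj_sym by (simp add: c_def last_rev)
  have "N \<ge> 3" using cIN big n3 N1 by linarith
  then obtain a b r where c: "c = a # b # r" using lc by (metis Suc_le_length_iff numeral_3_eq_3)
  have "walk (c @ [a, b])"
  proof (intro walk_append_no_bad nb)
    show "walk [a, b]" using wc c walk_append1[of "[a, b]" r] by simp
  qed (use wc adjc c in auto)
  then have cyc: "ccycle c" using dc setc pV \<open>N \<ge> 3\<close> lc c by (simp add: ccycle_def)
  have "set p = V"
  proof (rule ccontr)
    assume "set p \<noteq> V"
    then obtain v where v: "v \<in> V" "v \<notin> set p" using pV by blast
    have cp: "card (set p) = N" using dist distinct_card by (auto simp: N_def)
    \<comment> \<open>From N - 1 >= |I| the path has more than |V|/2 vertices, so too few others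
      remain to contain all neighbours of v.\<close>
    have "\<exists>y\<in>set p. adj v y"
    proof (rule ccontr)
      assume "\<not> ?thesis"
      then have "{y. adj v y} \<subseteq> V - insert v (set p)" using adj_V2 adj_irrefl by auto
      then have "card {y. adj v y} \<le> card (V - insert v (set p))" using fin_V by (intro card_mono) auto
      also have "\<dots> = card V - Suc N" using v pV fin_V cp by (subst card_Diff_subset) auto
      finally have "card {y. adj v y} \<le> card V - Suc N" .
      moreover have "Suc N \<le> card V" using card_mono[of V "insert v (set p)"] v pV fin_V cp by simp
      ultimately show False using mindeg[OF v(1)] cIN big N1 by linarith
    qed
    then obtain y where y: "y \<in> set c" "adj v y" using setc by blast
    obtain q where q: "ccycle (y # q)" "set (y # q) = set c" using ccycle_hd[OF cyc y(1)] by metis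
    have cq: "cpath (y # q)" by (rule ccycle_cpath[OF q(1)])
    have "walk ([v] @ y # q)" using cq y by (intro walk_append_no_bad nb) (auto simp: cpath_def)
    then have "cpath (v # y # q)" using cq v q setc by (auto simp: cpath_def)
    moreover have "length (y # q) = N" using q cq setc cp by (metis cpath_def distinct_card)
    ultimately show False using max[of "v # y # q"] by (simp add: N_def)
  qed
  then show ?thesis using cyc setc by blast
qed

section \<open>Walks and cycles by index\<close>

lemma walk_adj_nth: "walk xs \<Longrightarrow> Suc i < length xs \<Longrightarrow> adj (xs ! i) (xs ! Suc i)"
proof (induction xs arbitrary: i rule: walk.induct)
  case (1 a b c xs)
  then show ?case by (cases i) auto
qed auto

lemma walk_not_bad_nth:
  "walk xs \<Longrightarrow> Suc (Suc i) < length xs \<Longrightarrow> \<not> bad (xs ! i) (xs ! Suc i) (xs ! Suc (Suc i))"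
proof (induction xs arbitrary: i rule: walk.induct)
  case (1 a b c xs)
  then show ?case by (cases i) auto
qed auto

lemma ccycle_nth:
  assumes "ccycle c" "i < length c"
  shows "adj (c ! i) (c ! (Suc i mod length c))"
    and "\<not> bad (c ! i) (c ! (Suc i mod length c)) (c ! (Suc (Suc i) mod length c))"
proof -
  have c: "3 \<le> length c" "walk (c @ take 2 c)" using assms by (auto simp: ccycle_def)
  have nth: "(c @ take 2 c) ! j = c ! (j mod length c)" if "j < length c + 2" for j
    using that c by (auto simp: nth_append mod_if)
  have "length (c @ take 2 c) = length c + 2" using c by simp
  then show "adj (c ! i) (c ! (Suc i mod length c))"
    "\<not> bad (c ! i) (c ! (Suc i mod length c)) (c ! (Suc (Suc i) mod length c))"
    using walk_adj_nth[OF c(2), of i] walk_not_bad_nth[OF c(2), of i] assms(2) nth[of i] nth[of "Suc i"] nth[of "Suc (Suc i)"] by auto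
qed

end

section \<open>Closing paths and absorbing vertices\<close>

lemma near_mono: "near k M M' \<Longrightarrow> M \<subseteq> M2 \<Longrightarrow> near k M2 M'"
  unfolding near_def by blast

text \<open>Here eps plays the role of sqrt mu, so that d = mu n, and \<open>nonext\<close> denies
  the sparse pair of alternative (ii). \<open>big\<close> holds once some transition is bad: then
  eps^2 n >= 1, so eps n >= 1/eps > 400.\<close>

locale dense_transition_system = transition_system V adj bad "eps\<^sup>2 * real (card V)"
  for V :: "'a set" and adj bad and eps :: real +
  assumes eps0: "0 < eps" and eps1: "eps < 1 / 400" and big: "400 \<le> eps * real (card V)"
    and mindeg: "x \<in> V \<Longrightarrow> real (card V) / 2 \<le> real (card {y. adj x y})"
    and nonext: "A \<subseteq> V \<Longrightarrow> B \<subseteq> V \<Longrightarrow> real (card A) \<ge> (1/2 - 200 * eps) * real (card V)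
      \<Longrightarrow> real (card B) \<ge> (1/2 - 200 * eps) * real (card V)
      \<Longrightarrow> 16 * eps * (real (card V))\<^sup>2 < real (card {(x, y). x \<in> A \<and> y \<in> B \<and> adj x y})"
begin

abbreviation "n \<equiv> real (card V)"

section \<open>Numerical bounds and jammed vertices\<close>

lemma n_big: "n > 160000"
proof -
  have "n > 0" using big eps0 by (metis less_numeral_extra(3) mult_zero_right not_numeral_le_zero of_nat_0_less_iff gr0I of_nat_0)
  then have "eps * n < (1 / 400) * n" using eps1 by (intro mult_strict_right_mono) auto
  with big show ?thesis by linarith
qed

lemma eps_n: "eps * n \<le> n / 400" "eps\<^sup>2 * n \<le> eps * n / 400"
proof -
  show 1: "eps * n \<le> n / 400" using mult_right_mono[of eps "1/400" n] eps1 by simp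
  have "eps * (eps * n) \<le> eps * (n / 400)" using 1 eps0 by (intro mult_left_mono) auto
  then show "eps\<^sup>2 * n \<le> eps * n / 400" by (simp add: power2_eq_square mult.assoc)
qed

text \<open>The threshold balances two losses: at most eps n blocked neighbours for an unjammed
  vertex, and by Markov at most 2 eps^2 n^2 / (eps n) = 2 eps n jammed vertices.\<close>

definition jammed :: "'a set set \<Rightarrow> 'a set" where
  "jammed M = {x\<in>V. real (card (blocked M x)) > eps * n}"

lemma finite_jammed: "finite (jammed M)" using fin_V by (simp add: jammed_def)

lemma card_jammed:
  assumes "max_deg2 M" shows "real (card (jammed M)) \<le> 2 * (eps * n)"
proof -
  have p: "0 < eps * n" using big by linarith
  have "eps * n * real (card (jammed M)) \<le> 2 * (eps\<^sup>2 * n) * n"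
    using card_many_blocked[OF assms p] by (simp add: jammed_def)
  also have "\<dots> = eps * n * (2 * (eps * n))" by (simp add: power2_eq_square)
  finally show ?thesis using p by (simp only: mult_le_cancel_left_pos)
qed

text \<open>An adjacent pair that is not good is blocked seen from x or from y, and
  \<open>sum_blocked\<close> allows 2 eps^2 n^2 pairs in each direction.\<close>

lemma card_not_good:
  assumes "max_deg2 M"
  shows "real (card {(x, y). adj x y \<and> \<not> good_edge M x y}) \<le> 4 * eps\<^sup>2 * n\<^sup>2"
proof -
  let ?S = "SIGMA x:V. blocked M x"
  have fin: "finite ?S" using fin_V finite_blocked by auto
  have "{(x, y). adj x y \<and> \<not> good_edge M x y} \<subseteq> ?S \<union> ?S\<inverse>"
    using adj_V adj_V2 by (auto simp: good_edge_def blocked_def)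
  then have "card {(x, y). adj x y \<and> \<not> good_edge M x y} \<le> card (?S \<union> ?S\<inverse>)"
    using fin by (intro card_mono) auto
  also have "\<dots> \<le> card ?S + card (?S\<inverse>)" by (rule card_Un_le)
  also have "\<dots> = 2 * card ?S" by (simp add: card_inverse)
  finally have "real (card {(x, y). adj x y \<and> \<not> good_edge M x y}) \<le> 2 * real (card ?S)" by linarith
  also have "real (card ?S) = (\<Sum>x\<in>V. real (card (blocked M x)))"
    using fin_V finite_blocked by (simp add: card_SigmaI)
  also have "\<dots> \<le> 2 * (eps\<^sup>2 * n) * n" by (rule sum_blocked[OF assms])
  finally show ?thesis by (simp add: power2_eq_square)
qed

section \<open>Closing an almost spanning path\<close>

lemma segments:
  assumes "cpath p" "p = xs @ ys @ zs"
  shows "walk xs" "walk ys" "walk zs" "consec xs \<subseteq> consec p" "consec ys \<subseteq> consec p" "consec zs \<subseteq> consec p"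
proof -
  have w: "walk (xs @ ys @ zs)" using assms by (simp add: cpath_def)
  show "walk xs" using walk_append1[OF w] .
  show "walk ys" using walk_append1[OF walk_append2[OF w]] .
  show "walk zs" using walk_append2[OF walk_append2[OF w]] .
  show "consec xs \<subseteq> consec p" unfolding assms(2) by (rule consec_append_sub)
  have 1: "consec (ys @ zs) \<subseteq> consec p" unfolding assms(2) by (rule consec_append_sub)
  show "consec ys \<subseteq> consec p" "consec zs \<subseteq> consec p"
    using order_trans[OF consec_append_sub(1) 1] order_trans[OF consec_append_sub(2) 1] .
qed

text \<open>A path that cannot be closed yields, through \<open>sparse_pair_if_not_closable\<close>,
  sets with at most 5N good pairs; the other adjacent pairs are few by \<open>card_not_good\<close>,
  against \<open>nonext\<close>. The slack 12 covers two reroutings of six vertices each, the slack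
  3 one vertex cut out at the start and two more while absorbing.\<close>

lemma close_path:
  assumes p: "cpath p" and miss: "real (card (V - set p)) \<le> 2 * (eps * n) + 3"
    and hd: "real (card (blocked (consec p) (hd p))) \<le> eps * n + 12"
    and last: "real (card (blocked (consec p) (last p))) \<le> eps * n + 12"
  shows "\<exists>c. ccycle c \<and> set c = set p \<and> near 6 (consec p) (cycle_consec c)"
proof (rule ccontr)
  assume no: "\<not> ?thesis"
  define M where "M = consec p"
  define N where "N = length p"
  define G where "G = (\<lambda>i j. i < N \<and> j < N \<and> good_edge M (p ! i) (p ! j))"
  \<comment> \<open>The threshold lies 12 above that of \<open>jammed\<close>: \<open>Bd\<close>
    still consists of positions of jammed vertices, but the ends of the path stay outside.\<close>
  define Bd where "Bd = {i. i < N \<and> real (card (blocked M (p ! i))) > eps * n + 12}"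
  define h where "h = n / 2 - 3 * (eps * n) - 15 - 2 * (eps\<^sup>2 * n)"
  have dist: "distinct p" and pV: "set p \<subseteq> V" using p by (auto simp: cpath_def)
  have deg2: "max_deg2 M" unfolding M_def by (rule max_deg2_path[OF dist])
  have NV: "real N \<le> n" "n \<le> real N + 2 * (eps * n) + 3"
  proof -
    have "card (V - set p) = card V - card (set p)" "card (set p) \<le> card V"
      using pV fin_V by (auto intro: card_Diff_subset card_mono)
    moreover have "card (set p) = N" using dist distinct_card by (auto simp: N_def)
    ultimately show "real N \<le> n" "n \<le> real N + 2 * (eps * n) + 3" using miss by linarith+
  qed
  have "real N \<ge> 6" using NV n_big eps_n by linarith
  then have N6: "N \<ge> 6" by linarith
  then have ne: "p \<noteq> []" by (auto simp: N_def)
  have hl: "hd p = p ! 0" "last p = p ! (N - 1)" using ne by (auto simp: N_def hd_conv_nth last_conv_nth)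
  have fBd: "finite Bd" by (auto simp: Bd_def)
  have cBd: "real (card Bd) \<le> 2 * (eps * n)"
  proof -
    have "(!) p ` Bd \<subseteq> jammed M" using pV by (auto simp: Bd_def jammed_def N_def)
    moreover have "inj_on ((!) p) Bd" using dist by (auto simp: Bd_def N_def intro: inj_on_nth)
    ultimately have "card Bd \<le> card (jammed M)" by (metis card_image card_mono finite_jammed)
    then show ?thesis using card_jammed[OF deg2] by linarith
  qed
  have deg: "h \<le> real (card {j. j < N \<and> G i j})" if i: "i < N" "i \<notin> Bd" for i
  proof -
    let ?x = "p ! i" and ?Z = "{j. j < N \<and> G i j}"
    let ?Q = "{y. \<exists>z. {p ! i, z} \<in> M \<and> bad y (p ! i) z}"
    have xV: "?x \<in> V" using i pV by (auto simp: N_def)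
    have fQ: "finite ?Q" by (rule finite_subset[OF _ fin_V]) (use bad_V in blast)
    \<comment> \<open>A neighbour of the vertex at i is off the path, blocked, in conflict with an
      \<open>M\<close>-edge at i, or joined by a good edge. Subtracting the first three bounds from
      n/2 gives \<open>h\<close>.\<close>
    have "{y. adj ?x y} \<subseteq> (V - set p) \<union> blocked M ?x \<union> ?Q \<union> (!) p ` ?Z"
    proof
      fix y assume "y \<in> {y. adj ?x y}"
      then have a: "adj ?x y" by simp
      show "y \<in> (V - set p) \<union> blocked M ?x \<union> ?Q \<union> (!) p ` ?Z"
      proof (cases "y \<in> set p \<and> good_edge M ?x y")
        case True
        then obtain j where "j < N" "y = p ! j" by (auto simp: in_set_conv_nth N_def)
        then show ?thesis using True i by (auto simp: G_def)
      next
        case False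
        then show ?thesis using a adj_V2 by (auto simp: good_edge_def blocked_def)
      qed
    qed
    then have "card {y. adj ?x y} \<le> card ((V - set p) \<union> blocked M ?x \<union> ?Q \<union> (!) p ` ?Z)"
      using fin_V finite_blocked fQ by (intro card_mono) auto
    also have "\<dots> \<le> card (V - set p) + card (blocked M ?x) + card ?Q + card ?Z"
      by (intro order_trans[OF card_Un_le] add_mono order_refl card_image_le) auto
    finally have "card {y. adj ?x y} \<le> card (V - set p) + card (blocked M ?x) + card ?Q + card ?Z" .
    moreover have "real (card ?Q) \<le> 2 * (eps\<^sup>2 * n)" by (rule card_blocked_at[OF deg2])
    moreover have "real (card (blocked M ?x)) \<le> eps * n + 12" using i by (auto simp: Bd_def)
    ultimately show ?thesis using mindeg[OF xV] miss unfolding h_def by linarith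
  qed
  have fail: False if "ccycle c" "set c = set p" "near 6 M (cycle_consec c)" for c
    using no that unfolding M_def by blast
  have C0: "\<not> G x (N - 1)" if x: "1 \<le> x" "x + 3 \<le> N" "G 0 (Suc x)" for x
  proof
    assume g: "G x (N - 1)"
    define xs ys where "xs = take (Suc x) p" and "ys = drop (Suc x) p"
    have eq: "p = xs @ ys @ []" by (simp add: xs_def ys_def)
    have len: "length xs = Suc x" "length ys = N - Suc x" using x by (auto simp: xs_def ys_def N_def)
    note seg = segments[OF p eq, folded M_def]
    have nes: "xs \<noteq> []" "ys \<noteq> []" using len x by auto
    have v: "hd xs = p ! 0" "last xs = p ! x" "hd ys = p ! Suc x" "last ys = p ! (N - 1)"
      using x nes len by (auto simp: eq nth_append hd_conv_nth last_conv_nth)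
    \<comment> \<open>New edges between positions: x to N - 1 and x + 1 to 0.\<close>
    have "ccycle (xs @ rev ys) \<and> near 6 M (cycle_consec (xs @ rev ys))"
    proof (rule ccycle_two_segments)
      show "good_edge M (last xs) (hd (rev ys))" using g v by (simp add: hd_rev G_def)
      show "good_edge M (last (rev ys)) (hd xs)" using x v good_edge_sym by (simp add: last_rev G_def)
    qed (use seg dist pV eq len x in \<open>auto simp: walk_rev consec_rev\<close>)
    then show False using fail[of "xs @ rev ys"] eq by (metis append_Nil2 set_append set_rev)
  qed
  have C1: "\<not> G k x" if x: "1 \<le> x" "x + 3 \<le> k" "k + 2 \<le> N" "G 0 (Suc x)" "G (k - 1) (N - 1)" for x k
  proof
    assume g: "G k x"
    define xs ys zs where "xs = take (Suc x) p" and "ys = take (k - Suc x) (drop (Suc x) p)" and "zs = drop k p"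
    have z: "zs = drop (k - Suc x) (drop (Suc x) p)" using x by (simp add: zs_def)
    have eq: "p = xs @ ys @ zs" unfolding xs_def ys_def z by (simp only: append_take_drop_id)
    have len: "length xs = Suc x" "length ys = k - Suc x" "length zs = N - k" using x by (auto simp: xs_def ys_def zs_def N_def)
    note seg = segments[OF p eq, folded M_def]
    have nes: "xs \<noteq> []" "ys \<noteq> []" "zs \<noteq> []" using len x by auto
    have v: "hd xs = p ! 0" "last xs = p ! x" "hd ys = p ! Suc x" "last ys = p ! (k - 1)"
        "hd zs = p ! k" "last zs = p ! (N - 1)"
      using x nes len by (auto simp: eq nth_append hd_conv_nth last_conv_nth)
    \<comment> \<open>New edges: 0 to x + 1, k - 1 to N - 1, and k to x.\<close>
    have "ccycle (rev xs @ ys @ rev zs) \<and> near 6 M (cycle_consec (rev xs @ ys @ rev zs))"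
    proof (rule ccycle_three_segments)
      show "good_edge M (last (rev xs)) (hd ys)" using x v by (simp add: last_rev G_def)
      show "good_edge M (last ys) (hd (rev zs))" using x v by (simp add: hd_rev G_def)
      show "good_edge M (last (rev zs)) (hd (rev xs))" using g v by (simp add: last_rev hd_rev G_def)
    qed (use seg dist pV eq len x in \<open>auto simp: walk_rev consec_rev\<close>)
    moreover have "set (rev xs @ ys @ rev zs) = set p" using eq by simp
    ultimately show False using fail by blast
  qed
  have C2: "\<not> G k x" if x: "1 \<le> k" "k + 2 \<le> x" "x + 3 \<le> N" "G 0 (Suc x)" "G (Suc k) (N - 1)" for x k
  proof
    assume g: "G k x"
    define xs ys zs where "xs = take (Suc k) p" and "ys = take (x - k) (drop (Suc k) p)" and "zs = drop (Suc x) p"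
    have z: "zs = drop (x - k) (drop (Suc k) p)" using x by (simp add: zs_def)
    have eq: "p = xs @ ys @ zs" unfolding xs_def ys_def z by (simp only: append_take_drop_id)
    have len: "length xs = Suc k" "length ys = x - k" "length zs = N - Suc x" using x by (auto simp: xs_def ys_def zs_def N_def)
    note seg = segments[OF p eq, folded M_def]
    have nes: "xs \<noteq> []" "ys \<noteq> []" "zs \<noteq> []" using len x by auto
    have v: "hd xs = p ! 0" "last xs = p ! k" "hd ys = p ! Suc k" "last ys = p ! x"
        "hd zs = p ! Suc x" "last zs = p ! (N - 1)"
      using x nes len by (auto simp: eq nth_append hd_conv_nth last_conv_nth)
    \<comment> \<open>New edges: k + 1 to N - 1, x + 1 to 0, and k to x.\<close>
    have "ccycle (rev ys @ rev zs @ xs) \<and> near 6 M (cycle_consec (rev ys @ rev zs @ xs))"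
    proof (rule ccycle_three_segments)
      show "good_edge M (last (rev ys)) (hd (rev zs))" using x v by (simp add: last_rev hd_rev G_def)
      show "good_edge M (last (rev zs)) (hd xs)" using x v good_edge_sym by (simp add: last_rev G_def)
      show "good_edge M (last xs) (hd (rev ys))" using g v by (simp add: hd_rev G_def)
    qed (use seg dist pV eq len x in \<open>auto simp: walk_rev consec_rev\<close>)
    moreover have "set (rev ys @ rev zs @ xs) = set p" using eq by auto
    ultimately show False using fail by blast
  qed
  have ends: "0 \<notin> Bd" "N - 1 \<notin> Bd" using hd last hl unfolding Bd_def M_def by auto
  have sym: "G i j \<Longrightarrow> G j i" for i j using good_edge_sym by (auto simp: G_def)
  obtain A B where AB: "A \<subseteq> {..<N}" "B \<subseteq> {..<N}"
      "real (card A) \<ge> h - 7 * (real N - 2 * h) - 70 - 4 * real (card Bd)"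
      "real (card B) \<ge> h - 7 * (real N - 2 * h) - 70 - 4 * real (card Bd)"
      and few: "card {(x, y). x \<in> A \<and> y \<in> B \<and> G x y} \<le> 5 * N"
    using sparse_pair_if_not_closable[of G N Bd h, OF sym deg fBd ends N6 refl C0 C1 C2] by auto
  \<comment> \<open>With e = eps n and f = eps^2 n one gets N - 2h <= 6e + 30 + 4f, so the loss
    against n/2 is at most 53e + 30f + 295, well below 200e.\<close>
  have size: "h - 7 * (real N - 2 * h) - 70 - 4 * real (card Bd) \<ge> (1/2 - 200 * eps) * n"
  proof -
    have *: "(1/2 - 200 * eps) * n = n / 2 - 200 * (eps * n)" by (simp add: algebra_simps)
    define e f where "e = eps * n" and "f = eps\<^sup>2 * n"
    have "real (card Bd) \<le> 2 * e" "f \<le> e / 400" "400 \<le> e" "h = n / 2 - 3 * e - 15 - 2 * f"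
      using cBd eps_n big by (auto simp: e_def f_def h_def)
    then show ?thesis using NV(1) unfolding * e_def[symmetric] by argo
  qed
  have inj: "inj_on ((!) p) {..<N}" using dist by (auto simp: N_def intro: inj_on_nth)
  define A' B' where "A' = (!) p ` A" and "B' = (!) p ` B"
  have card: "card A' = card A" "card B' = card B"
    using inj AB unfolding A'_def B'_def by (auto intro: card_image inj_on_subset)
  have inV: "p ! i \<in> V" if "i < N" for i using that pV nth_mem by (auto simp: N_def)
  have sub: "A' \<subseteq> V" "B' \<subseteq> V" using AB(1,2) inV by (auto simp: A'_def B'_def)
  let ?T = "{(x, y). x \<in> A' \<and> y \<in> B' \<and> adj x y}"
  let ?I = "{(x, y). x \<in> A \<and> y \<in> B \<and> G x y}"
  have finI: "finite ?I" by (rule finite_subset[of _ "{..<N} \<times> {..<N}"]) (use AB in auto)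
  have finB: "finite {(x, y). adj x y \<and> \<not> good_edge M x y}"
    by (rule finite_subset[of _ "V \<times> V"]) (use adj_V adj_V2 fin_V in auto)
  have "?T \<subseteq> map_prod ((!) p) ((!) p) ` ?I \<union> {(x, y). adj x y \<and> \<not> good_edge M x y}"
  proof
    fix t assume "t \<in> ?T"
    then obtain i j where ij: "i \<in> A" "j \<in> B" "t = (p ! i, p ! j)" "adj (p ! i) (p ! j)"
      by (auto simp: A'_def B'_def)
    show "t \<in> map_prod ((!) p) ((!) p) ` ?I \<union> {(x, y). adj x y \<and> \<not> good_edge M x y}"
    proof (cases "good_edge M (p ! i) (p ! j)")
      case True
      then have "(i, j) \<in> ?I" using ij AB(1,2) by (auto simp: G_def)
      moreover have "t = map_prod ((!) p) ((!) p) (i, j)" using ij by simp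
      ultimately show ?thesis by blast
    qed (use ij in auto)
  qed
  then have "card ?T \<le> card (map_prod ((!) p) ((!) p) ` ?I \<union> {(x, y). adj x y \<and> \<not> good_edge M x y})"
    using finI finB by (intro card_mono) auto
  also have "\<dots> \<le> card ?I + card {(x, y). adj x y \<and> \<not> good_edge M x y}"
    by (intro order_trans[OF card_Un_le] add_mono order_refl card_image_le finI)
  finally have "real (card ?T) \<le> 5 * real N + 4 * eps\<^sup>2 * n\<^sup>2"
    using few card_not_good[OF deg2] by linarith
  moreover have "16 * eps * n\<^sup>2 < real (card ?T)"
    using nonext[OF sub] card AB size by linarith
  moreover have "4 * eps\<^sup>2 * n\<^sup>2 \<le> eps * n\<^sup>2"
  proof -
    have "(eps\<^sup>2 * n) * n \<le> (eps * n / 400) * n" using eps_n by (intro mult_right_mono) auto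
    moreover have "4 * eps\<^sup>2 * n\<^sup>2 = 4 * ((eps\<^sup>2 * n) * n)" "(eps * n / 400) * n = eps * n\<^sup>2 / 400"
      by (simp_all add: power2_eq_square)
    moreover have "0 \<le> eps * n\<^sup>2" using eps0 by simp
    ultimately show ?thesis by linarith
  qed
  moreover have "n \<le> eps * n\<^sup>2"
  proof -
    have "1 * n \<le> (eps * n) * n" using big by (intro mult_right_mono) auto
    then show ?thesis by (simp add: power2_eq_square)
  qed
  moreover have "eps * n\<^sup>2 > 0" using eps0 n_big by simp
  \<comment> \<open>Altogether 5N + 4 eps^2 n^2 <= 5 eps n^2 + eps n^2, less than the 16 eps n^2
    that \<open>nonext\<close> demands.\<close>
  ultimately show False using NV by linarith
qed

section \<open>Absorbing missing vertices\<close>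

lemma miss_delete:
  assumes "y \<in> W" "W \<subseteq> V" shows "card (V - (W - {y})) = Suc (card (V - W))"
proof -
  have "V - (W - {y}) = insert y (V - W)" using assms by auto
  then show ?thesis using assms fin_V by simp
qed

lemma ccycle_Cons:
  assumes "ccycle (y # q)"
  shows "cpath q" "q \<noteq> []" "consec q \<subseteq> cycle_consec (y # q)"
    "{y, hd q} \<in> cycle_consec (y # q)" "{y, last q} \<in> cycle_consec (y # q)"
proof -
  show ne: "q \<noteq> []" using assms by (auto simp: ccycle_def)
  have "walk (y # q)" using ccycle_cpath[OF assms] by (simp add: cpath_def)
  then show "cpath q" using assms walk_Cons by (auto simp: cpath_def ccycle_def)
  have "cycle_consec (y # q) = insert {y, hd q} (insert {last q, y} (consec q))"
    using ne by (simp add: consec_Cons consec_append)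
  then show "consec q \<subseteq> cycle_consec (y # q)" "{y, hd q} \<in> cycle_consec (y # q)" "{y, last q} \<in> cycle_consec (y # q)"
    by (auto simp: insert_commute)
qed

lemma not_jammed: "x \<in> V \<Longrightarrow> x \<notin> jammed M \<Longrightarrow> real (card (blocked M x)) \<le> eps * n"
  by (auto simp: jammed_def)

text \<open>The rest of the cycle is a path ending in the two cycle neighbours of y, which are not
  jammed, so \<open>close_path\<close> applies.\<close>

lemma delete_vertex:
  assumes c: "ccycle c" and y: "y \<in> set c" and miss: "real (card (V - set c)) \<le> 2 * (eps * n) + 2"
    and nb: "\<And>w. {y, w} \<in> cycle_consec c \<Longrightarrow> w \<notin> jammed (cycle_consec c)"
  obtains c' where "ccycle c'" "set c' = set c - {y}" "near 6 (cycle_consec c) (cycle_consec c')"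
proof -
  obtain q where q: "ccycle (y # q)" "set (y # q) = set c" "cycle_consec (y # q) = cycle_consec c"
    using ccycle_hd[OF c y] .
  note qq = ccycle_Cons[OF q(1), unfolded q(3)]
  have cV: "set c \<subseteq> V" using c by (simp add: ccycle_def)
  have setq: "set q = set c - {y}" using q(1,2) by (auto simp: ccycle_def)
  have ends: "real (card (blocked (consec q) w)) \<le> eps * n + 12" if "w = hd q \<or> w = last q" for w
  proof -
    have "w \<in> V" using that qq(2) setq cV hd_in_set last_in_set by blast
    moreover have "w \<notin> jammed (cycle_consec c)" using that nb qq(4,5) by blast
    ultimately have "real (card (blocked (cycle_consec c) w)) \<le> eps * n" by (rule not_jammed)
    moreover have "card (blocked (consec q) w) \<le> card (blocked (cycle_consec c) w)"
      by (intro card_mono finite_blocked blocked_mono qq)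
    ultimately show ?thesis by linarith
  qed
  have "real (card (V - set q)) \<le> 2 * (eps * n) + 3"
    using miss miss_delete[OF y cV] unfolding setq by linarith
  then obtain c' where "ccycle c'" "set c' = set q" "near 6 (consec q) (cycle_consec c')"
    using close_path[OF qq(1)] ends by blast
  then show ?thesis using that setq near_mono qq(3) by blast
qed

text \<open>Missing, forbidden and jammed vertices and the cycle neighbours of jammed ones number at
  most (2 eps n + 3) + (2 eps n + 12) + 2 eps n + 4 eps n, less than n/2. The last conclusion
  permits deleting y, or opening the cycle there.\<close>

lemma pick_vertex:
  assumes c: "ccycle c" and v: "v \<in> V" and miss: "real (card (V - set c)) \<le> 2 * (eps * n) + 3"
    and X: "finite X" "real (card X) \<le> 2 * (eps * n) + 12"
  obtains y where "y \<in> set c" "adj v y" "y \<notin> X" "y \<notin> jammed (cycle_consec c)"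
    "\<And>w. {y, w} \<in> cycle_consec c \<Longrightarrow> w \<notin> jammed (cycle_consec c)"
proof -
  let ?M = "cycle_consec c"
  let ?Y = "\<Union>w\<in>jammed ?M. {y. {w, y} \<in> ?M}"
  have d2: "max_deg2 ?M" by (rule max_deg2_cycle[OF c])
  have "card ?Y \<le> (\<Sum>w\<in>jammed ?M. card {y. {w, y} \<in> ?M})"
    by (rule card_UN_le[OF finite_jammed])
  also have "\<dots> \<le> of_nat (card (jammed ?M)) * 2"
    by (rule sum_bounded_above) (use d2 in \<open>simp add: max_deg2_def\<close>)
  finally have Y: "card ?Y \<le> 2 * card (jammed ?M)" by simp
  have finY: "finite ?Y" using finite_jammed d2 by (auto simp: max_deg2_def)
  have "\<not> {y. adj v y} \<subseteq> (V - set c) \<union> X \<union> jammed ?M \<union> ?Y"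
  proof
    assume "{y. adj v y} \<subseteq> (V - set c) \<union> X \<union> jammed ?M \<union> ?Y"
    then have "card {y. adj v y} \<le> card ((V - set c) \<union> X \<union> jammed ?M \<union> ?Y)"
      by (intro card_mono) (use finY finite_jammed X fin_V in auto)
    also have "\<dots> \<le> card (V - set c) + card X + card (jammed ?M) + card ?Y"
      by (intro order_trans[OF card_Un_le] add_mono order_refl)
    finally have 1: "card {y. adj v y} \<le> card (V - set c) + card X + card (jammed ?M) + card ?Y" .
    have "real (card {y. adj v y}) \<le> 10 * (eps * n) + 15"
      using 1 Y card_jammed[OF d2] miss X(2) by linarith
    then show False using mindeg[OF v] eps_n n_big by linarith
  qed
  then obtain y where y: "adj v y" "y \<notin> V - set c" "y \<notin> X" "y \<notin> jammed ?M" "y \<notin> ?Y" by blast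
  have "w \<notin> jammed ?M" if "{y, w} \<in> ?M" for w
    using y(5) that by (auto simp: insert_commute)
  moreover have "y \<in> set c" using y(1,2) adj_V2 by blast
  ultimately show ?thesis using that y by blast
qed

text \<open>The neighbours y and z of v are removed one at a time, so that z is chosen against the
  cycle already closed without y. The path z v y is then attached at a vertex x where the remaining
  cycle is opened.\<close>

lemma insert_vertex:
  assumes c: "ccycle c" and v: "v \<in> V" "v \<notin> set c" and miss: "real (card (V - set c)) \<le> 2 * (eps * n) + 1"
  shows "\<exists>c'. ccycle c' \<and> set c' = insert v (set c)"
proof -
  let ?M = "cycle_consec c"
  have cV: "set c \<subseteq> V" using c by (simp add: ccycle_def)
  have e: "eps * n \<ge> 400" "eps\<^sup>2 * n \<le> eps * n / 400" using big eps_n by auto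
  obtain y where y: "y \<in> set c" "adj v y" "y \<notin> jammed ?M" "\<And>w. {y, w} \<in> ?M \<Longrightarrow> w \<notin> jammed ?M"
    using pick_vertex[OF c v(1), of "{}"] miss e by auto
  obtain c1 where c1: "ccycle c1" "set c1 = set c - {y}" "near 6 ?M (cycle_consec c1)"
    using delete_vertex[OF c y(1)] miss y(4) by auto
  let ?M1 = "cycle_consec c1"
  have m1: "card (V - set c1) = Suc (card (V - set c))" unfolding c1(2) by (rule miss_delete[OF y(1) cV])
  obtain z where z: "z \<in> set c1" "adj v z" "\<not> bad y v z" "z \<notin> jammed ?M1" "\<And>w. {z, w} \<in> ?M1 \<Longrightarrow> w \<notin> jammed ?M1"
  proof -
    have "real (card {w. bad y v w}) \<le> 2 * (eps * n) + 12" using bad_bound[of y v] e by linarith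
    moreover have "real (card (V - set c1)) \<le> 2 * (eps * n) + 3" using miss m1 by linarith
    ultimately show ?thesis using pick_vertex[OF c1(1) v(1), of "{w. bad y v w}"] finite_bad(1) that by blast
  qed
  obtain c2 where c2: "ccycle c2" "set c2 = set c1 - {z}" "near 6 ?M1 (cycle_consec c2)"
  proof -
    have "real (card (V - set c1)) \<le> 2 * (eps * n) + 2" using miss m1 by linarith
    then show ?thesis using delete_vertex[OF c1(1) z(1)] z(5) that by blast
  qed
  let ?M2 = "cycle_consec c2"
  have c1V: "set c1 \<subseteq> V" and c2V: "set c2 \<subseteq> V" using c1 c2 by (auto simp: ccycle_def)
  have m2: "card (V - set c2) = Suc (card (V - set c1))" unfolding c2(2) by (rule miss_delete[OF z(1) c1V])
  have yV: "y \<in> V" and zV: "z \<in> V" using y z cV c1V by auto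
  \<comment> \<open>Since their choice y has seen two reroutings and z one, each adding at most
    6.\<close>
  have by2: "real (card (blocked ?M2 y)) \<le> eps * n + 12"
    using not_jammed[OF yV y(3)] card_blocked_near[OF c1(3), of y] card_blocked_near[OF c2(3), of y] by linarith
  have bz2: "real (card (blocked ?M2 z)) \<le> eps * n + 6"
    using not_jammed[OF zV z(4)] card_blocked_near[OF c2(3), of z] by linarith
  \<comment> \<open>The transition v y x is allowed and, x not being blocked, so is passing from y
    through x to either cycle neighbour. The unjammed neighbours of x guarantee a usable end once
    the cycle is opened there.\<close>
  obtain x where x: "x \<in> set c2" "adj y x" "\<not> bad v y x" "x \<notin> blocked ?M2 y" "\<And>w. {x, w} \<in> ?M2 \<Longrightarrow> w \<notin> jammed ?M2"
  proof -
    let ?X = "blocked ?M2 y \<union> {w. bad v y w}"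
    have "card ?X \<le> card (blocked ?M2 y) + card {w. bad v y w}" by (rule card_Un_le)
    then have "real (card ?X) \<le> 2 * (eps * n) + 12" using by2 bad_bound[of v y] e by linarith
    moreover have "finite ?X" using finite_blocked finite_bad by blast
    moreover have "real (card (V - set c2)) \<le> 2 * (eps * n) + 3" using miss m1 m2 by linarith
    ultimately show ?thesis using pick_vertex[OF c2(1) yV, of ?X] that by blast
  qed
  obtain q where q: "ccycle (x # q)" "set (x # q) = set c2" "cycle_consec (x # q) = ?M2"
    using ccycle_hd[OF c2(1) x(1)] .
  note qq = ccycle_Cons[OF q(1), unfolded q(3)]
  \<comment> \<open>The free ends are z and \<open>last q\<close>, the cycle neighbour of x opposite
    to \<open>hd q\<close>.\<close>
  define p where "p = z # v # y # x # q"
  have wq: "walk (x # q)" using ccycle_cpath[OF q(1)] by (simp add: cpath_def)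
  have "\<not> bad y x (hd q)" using x(4) qq(4) by (auto simp: blocked_def)
  then have "walk (y # x # q)" using x(2) wq qq(2) by (cases q) auto
  then have "walk (v # y # x # q)" using x(3) y(2) by simp
  then have wp: "walk p" unfolding p_def using z(2,3) adj_sym bad_sym by auto
  have setp: "set p = insert v (set c)" unfolding p_def using q(2) c1(2) c2(2) y(1) z(1) by auto
  have "distinct p"
    unfolding p_def using q(1,2) c1(2) c2(2) y z v by (auto simp: ccycle_def)
  then have cp: "cpath p" using wp setp cV v by (simp add: cpath_def)
  have near: "near 6 ?M2 (consec p)"
  proof -
    have "consec (x # q) \<subseteq> ?M2" using qq by (simp add: consec_Cons)
    then have "\<forall>e\<in>consec p. e \<in> ?M2 \<or> e \<subseteq> {z, v, y, x}" unfolding p_def by auto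
    moreover have "card {z, v, y, x} \<le> 6" using card_length[of "[z, v, y, x]"] by simp
    ultimately show ?thesis unfolding near_def by (intro exI[of _ "{z, v, y, x}"]) simp
  qed
  have "real (card (blocked (consec p) (hd p))) \<le> eps * n + 12"
    using bz2 card_blocked_near[OF near, of z] by (simp add: p_def)
  moreover have "real (card (blocked (consec p) (last p))) \<le> eps * n + 12"
  proof -
    have "last q \<in> V" using q(2) c2V qq(2) last_in_set by auto
    moreover have "last q \<notin> jammed ?M2" using x(5) qq(5) by blast
    ultimately have "real (card (blocked ?M2 (last q))) \<le> eps * n" by (rule not_jammed)
    then show ?thesis using card_blocked_near[OF near, of "last q"] qq(2) by (simp add: p_def)
  qed
  moreover have "real (card (V - set p)) \<le> 2 * (eps * n) + 3"
  proof -
    have "card (V - set p) \<le> card (V - set c)" unfolding setp using fin_V by (intro card_mono) auto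
    then show ?thesis using miss by linarith
  qed
  ultimately show ?thesis using close_path[OF cp] setp by auto
qed

lemma extend_to_hamilton:
  assumes "ccycle c" "real (card (V - set c)) \<le> 2 * (eps * n) + 1"
  shows "\<exists>c'. ccycle c' \<and> set c' = V"
  using assms
proof (induction "card (V - set c)" arbitrary: c)
  case 0
  then have "V - set c = {}" using fin_V by simp
  then show ?case using 0 by (auto simp: ccycle_def)
next
  case (Suc k)
  then obtain v where v: "v \<in> V" "v \<notin> set c" by (metis Diff_iff card.empty ex_in_conv nat.distinct(1))
  obtain c' where c': "ccycle c'" "set c' = insert v (set c)" using insert_vertex[OF Suc(3) v Suc(4)] by blast
  have "V - set c = insert v (V - set c')" using v c' by auto
  moreover have "v \<notin> V - set c'" using c' by auto
  ultimately have "card (V - set c) = Suc (card (V - set c'))" using fin_V by simp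
  then have "k = card (V - set c')" "real (card (V - set c')) \<le> 2 * (eps * n) + 1" using Suc(2,4) by linarith+
  then show ?case using Suc(1) c'(1) by blast
qed

text \<open>Jammed vertices need only be cut off at the two ends, up to the first and from the last
  unjammed vertex on; those in between may stay. Together with v at most 2 eps n + 1 vertices are
  then missing, few enough to be absorbed.\<close>

lemma hamilton_of_almost_spanning_path:
  assumes q: "cpath q" "set q = V - {v}"
  shows "\<exists>c. ccycle c \<and> set c = V"
proof -
  let ?M = "consec q"
  let ?g = "\<lambda>x. x \<notin> jammed ?M"
  have dq: "distinct q" using q by (simp add: cpath_def)
  have J: "real (card (jammed ?M)) \<le> 2 * (eps * n)" by (rule card_jammed[OF max_deg2_path[OF dq]])
  have "\<exists>x\<in>set q. ?g x"
  proof (rule ccontr)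
    assume "\<not> ?thesis"
    then have "V \<subseteq> insert v (jammed ?M)" using q(2) by auto
    then have "card V \<le> card (insert v (jammed ?M))" using finite_jammed by (intro card_mono) auto
    also have "\<dots> \<le> Suc (card (jammed ?M))" by (simp add: card_insert_if finite_jammed)
    finally show False using J eps_n n_big by linarith
  qed
  then obtain us a ws where 1: "q = us @ a # ws" "?g a" "\<forall>x\<in>set us. \<not> ?g x"
    using split_list_first_prop[of q ?g] by blast
  have "\<exists>x\<in>set (a # ws). ?g x" using 1 by simp
  then obtain ps b vs where 2: "a # ws = ps @ b # vs" "?g b" "\<forall>x\<in>set vs. \<not> ?g x"
    using split_list_last_prop[of "a # ws" ?g] by blast
  define p where "p = ps @ [b]"
  have eq: "q = us @ p @ vs" using 1 2 by (simp add: p_def)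
  have hl: "hd p = a" "last p = b" using 2(1) by (cases ps; simp add: p_def)+
  note seg = segments[OF q(1) eq]
  have pV: "set p \<subseteq> V" using eq q by auto
  have cp: "cpath p" using seg dq eq pV by (auto simp: cpath_def)
  have "a \<in> V" "b \<in> V" using pV hl hd_in_set[of p] last_in_set[of p] by (auto simp: p_def)
  have bl: "real (card (blocked (consec p) x)) \<le> eps * n + 12" if "x \<in> V" "?g x" for x
  proof -
    have "card (blocked (consec p) x) \<le> card (blocked ?M x)"
      by (intro card_mono finite_blocked blocked_mono seg)
    then show ?thesis using not_jammed[OF that] by linarith
  qed
  have "V - set p \<subseteq> insert v (jammed ?M)" using q(2) eq 1(3) 2(3) by auto
  then have "card (V - set p) \<le> card (insert v (jammed ?M))" using finite_jammed by (intro card_mono) auto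
  also have "\<dots> \<le> Suc (card (jammed ?M))" by (simp add: card_insert_if finite_jammed)
  finally have m: "real (card (V - set p)) \<le> 2 * (eps * n) + 1" using J by linarith
  have ha: "real (card (blocked (consec p) (hd p))) \<le> eps * n + 12"
    and lb: "real (card (blocked (consec p) (last p))) \<le> eps * n + 12"
    unfolding hl using bl \<open>a \<in> V\<close> \<open>b \<in> V\<close> 1(2) 2(2) by auto
  have "real (card (V - set p)) \<le> 2 * (eps * n) + 3" using m by linarith
  then obtain c where "ccycle c" "set c = set p" using close_path[OF cp _ ha lb] by blast
  then show ?thesis using extend_to_hamilton[of c] m by simp
qed

end

section \<open>Compatible Hamilton cycles\<close>

text \<open>Only transitions centred on the walk matter, so changes of \<open>bad\<close> at
  vertices off the walk are harmless.\<close>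

lemma (in transition_system) walk_fewer_bad:
  assumes "transition_system.walk adj bad' xs" "transition_system V adj bad' d'"
    "\<And>x y z. y \<in> set xs \<Longrightarrow> bad x y z \<Longrightarrow> bad' x y z"
  shows "walk xs"
  using assms
proof (induction xs)
  case (Cons x xs)
  interpret T: transition_system V adj bad' d' by fact
  have "walk xs" using Cons T.walk_Cons by auto
  moreover have "adj x (hd xs)" if "xs \<noteq> []" using Cons.prems(1) that by (cases xs rule: walk.cases) auto
  moreover have "\<not> bad x (hd xs) (hd (tl xs))" if ne: "tl xs \<noteq> []"
  proof -
    obtain b c r where "xs = b # c # r" using ne by (cases xs rule: consec.cases) auto
    then show ?thesis using Cons.prems(1) Cons.prems(3)[of b x c] by auto
  qed
  ultimately show ?case by (rule walk_ConsI)
qed simp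

text \<open>Only \<open>bad\<close> varies in the induction; the conditions on degrees and sparse
  pairs concern \<open>adj\<close> alone and persist.\<close>

theorem compatible_hamilton:
  fixes V :: "'a set" and eps :: real
  assumes "transition_system V adj bad (eps\<^sup>2 * real (card V))"
    and eps: "0 < eps" "eps < 1 / 400" and n3: "card V \<ge> 3"
    and mindeg: "\<And>x. x \<in> V \<Longrightarrow> real (card V) / 2 \<le> real (card {y. adj x y})"
    and nonext: "\<And>A B. A \<subseteq> V \<Longrightarrow> B \<subseteq> V \<Longrightarrow> real (card A) \<ge> (1/2 - 200 * eps) * real (card V)
      \<Longrightarrow> real (card B) \<ge> (1/2 - 200 * eps) * real (card V)
      \<Longrightarrow> 16 * eps * (real (card V))\<^sup>2 < real (card {(x, y). x \<in> A \<and> y \<in> B \<and> adj x y})"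
  shows "\<exists>c. transition_system.ccycle V adj bad c \<and> set c = V"
  using assms(1)
proof (induction "card {(a, b, c). bad a b c}" arbitrary: bad rule: less_induct)
  case less
  interpret T: transition_system V adj bad "eps\<^sup>2 * real (card V)" by (rule less.prems)
  show ?case
  proof (cases "\<exists>a b c. bad a b c")
    case False
    then show ?thesis using T.dirac n3 mindeg by blast
  next
    case True
    then obtain a b c where abc: "bad a b c" by blast
    have "{c. bad a b c} \<noteq> {}" using abc by blast
    then have "card {c. bad a b c} \<ge> 1" using T.finite_bad(1)[of a b] by (simp add: Suc_le_eq card_gt_0_iff)
    then have one: "1 \<le> eps * (eps * real (card V))"
      using T.bad_bound[of a b] by (simp add: power2_eq_square mult.assoc)
    have "400 \<le> eps * real (card V)"
    proof (rule ccontr)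
      assume "\<not> ?thesis"
      then have "eps * (eps * real (card V)) < eps * 400" using eps by (intro mult_strict_left_mono) auto
      then show False using one eps by linarith
    qed
    then interpret D: dense_transition_system V adj bad eps
      using eps mindeg nonext by unfold_locales auto
    \<comment> \<open>The reverse triple is dropped as well, to keep \<open>bad'\<close>
      symmetric.\<close>
    define bad' where "bad' = (\<lambda>x y z. bad x y z \<and> (x, y, z) \<noteq> (a, b, c) \<and> (x, y, z) \<noteq> (c, b, a))"
    have T': "transition_system V adj bad' (eps\<^sup>2 * real (card V))"
    proof
      fix x y
      have "card {z. bad' x y z} \<le> card {z. bad x y z}"
        using T.finite_bad by (intro card_mono) (auto simp: bad'_def)
      then show "real (card {z. bad' x y z}) \<le> eps\<^sup>2 * real (card V)" using T.bad_bound[of x y] by linarith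
    qed (use T.fin_V T.adj_sym T.adj_irrefl T.adj_V T.bad_sym T.bad_adj in \<open>auto simp: bad'_def\<close>)
    interpret T': transition_system V adj bad' "eps\<^sup>2 * real (card V)" by (rule T')
    have "finite {(a, b, c). bad a b c}"
      by (rule finite_subset[of _ "V \<times> V \<times> V"]) (use T.bad_V T.fin_V in auto)
    moreover have "{(a, b, c). bad' a b c} \<subset> {(a, b, c). bad a b c}"
    proof
      show "{(a, b, c). bad' a b c} \<subseteq> {(a, b, c). bad a b c}" by (auto simp: bad'_def)
      have "(a, b, c) \<notin> {(a, b, c). bad' a b c}" "(a, b, c) \<in> {(a, b, c). bad a b c}"
        using abc by (auto simp: bad'_def)
      then show "{(a, b, c). bad' a b c} \<noteq> {(a, b, c). bad a b c}" by metis
    qed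
    ultimately have "card {(a, b, c). bad' a b c} < card {(a, b, c). bad a b c}" by (rule psubset_card_mono)
    then obtain cs where cs: "T'.ccycle cs" "set cs = V" using less.hyps[OF _ T'] by blast
    have "b \<in> set cs" using cs T.bad_V abc by blast
    then obtain q where q: "T'.ccycle (b # q)" "set (b # q) = V"
      using T'.ccycle_hd[OF cs(1)] cs(2) by metis
    have "T'.walk (b # q)" using T'.ccycle_cpath[OF q(1)] by (simp add: T'.cpath_def)
    then have "T'.walk q" by (rule T'.walk_Cons)
    moreover have bq: "b \<notin> set q" "distinct q" using q(1) by (auto simp: T'.ccycle_def)
    \<comment> \<open>All dropped transitions are centred at b, which is not on q.\<close>
    ultimately have "T.walk q" by (intro T.walk_fewer_bad[OF _ T']) (auto simp: bad'_def)
    then have "T.cpath q" using bq q by (auto simp: T.cpath_def)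
    moreover have "set q = V - {b}" using q bq by auto
    ultimately show ?thesis by (rule D.hamilton_of_almost_spanning_path)
  qed
qed

section \<open>From incompatibility systems to transition systems\<close>

lemma simple_graph_edge:
  assumes "simple_graph V E" "{x, y} \<in> E"
  shows "x \<in> V" "y \<in> V" "x \<noteq> y"
  using assms by (auto simp: simple_graph_def)

lemma simple_graph_no_loop: "simple_graph V E \<Longrightarrow> {x} \<notin> E"
  by (auto simp: simple_graph_def)

lemma degree_eq_card_neighbours:
  assumes "simple_graph V E" shows "degree E v = card {y. {v, y} \<in> E}"
proof -
  have "{e\<in>E. v \<in> e} = (\<lambda>y. {v, y}) ` {y. {v, y} \<in> E}"
  proof
    show "{e\<in>E. v \<in> e} \<subseteq> (\<lambda>y. {v, y}) ` {y. {v, y} \<in> E}"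
    proof
      fix e assume e: "e \<in> {e\<in>E. v \<in> e}"
      then have "card e = 2" using assms by (auto simp: simple_graph_def)
      then obtain y where "e = {v, y}" using e by (auto simp: card_2_iff)
      then show "e \<in> (\<lambda>y. {v, y}) ` {y. {v, y} \<in> E}" using e by auto
    qed
  qed auto
  moreover have "inj_on (\<lambda>y. {v, y}) {y. {v, y} \<in> E}"
    by (auto simp: inj_on_def doubleton_eq_iff)
  ultimately show ?thesis by (simp add: degree_def card_image)
qed

definition bad_transition :: "'a set set \<Rightarrow> ('a \<Rightarrow> 'a set set set) \<Rightarrow> 'a \<Rightarrow> 'a \<Rightarrow> 'a \<Rightarrow> bool" where
  "bad_transition E F a b c \<longleftrightarrow> {a, b} \<in> E \<and> {b, c} \<in> E \<and> incompatible F {a, b} {b, c}"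

lemma incompatible_at:
  assumes "incompatibility_system E F" "{e, e'} \<in> F v"
  shows "e \<inter> e' = {v}" "e \<noteq> e'"
proof -
  obtain f f' where f: "{e, e'} = {f, f'}" "f \<noteq> f'" "f \<inter> f' = {v}"
    using assms unfolding incompatibility_system_def by meson
  then show "e \<inter> e' = {v}" "e \<noteq> e'" by (auto simp: doubleton_eq_iff)
qed

lemma transition_system_of_graph:
  assumes G: "simple_graph V E" and F: "incompatibility_system E F" "bounded_system E F d" and d: "0 \<le> d"
  shows "transition_system V (\<lambda>x y. {x, y} \<in> E) (bad_transition E F) d"
proof
  show "finite V" using G by (simp add: simple_graph_def)
  show "bad_transition E F a b c \<Longrightarrow> bad_transition E F c b a" for a b c
    by (auto simp: bad_transition_def incompatible_def insert_commute)
  show "real (card {c. bad_transition E F a b c}) \<le> d" for a b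
  proof (cases "{a, b} \<in> E")
    case True
    let ?S = "{e'\<in>E. b \<in> e' \<and> e' \<noteq> {a, b} \<and> {{a, b}, e'} \<in> F b}"
    have sub: "(\<lambda>c. {b, c}) ` {c. bad_transition E F a b c} \<subseteq> ?S"
    proof
      fix e assume "e \<in> (\<lambda>c. {b, c}) ` {c. bad_transition E F a b c}"
      then obtain c v where c: "e = {b, c}" "{b, c} \<in> E" "{{a, b}, {b, c}} \<in> F v"
        by (auto simp: bad_transition_def incompatible_def)
      note at = incompatible_at[OF F(1) c(3)]
      \<comment> \<open>\<open>incompatible\<close> does not prescribe the vertex v, but v is the
        only common vertex of the two edges, hence b.\<close>
      then have "v = b" by auto
      then show "e \<in> ?S" using c at(2) by auto
    qed
    have "finite E" using G unfolding simple_graph_def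
      by (meson finite_Pow_iff finite_subset PowI subsetI)
    then have "card ((\<lambda>c. {b, c}) ` {c. bad_transition E F a b c}) \<le> card ?S"
      using sub by (intro card_mono) auto
    moreover have "inj_on (\<lambda>c. {b, c}) {c. bad_transition E F a b c}"
      by (auto simp: inj_on_def doubleton_eq_iff)
    ultimately have "card {c. bad_transition E F a b c} \<le> card ?S" by (simp add: card_image)
    moreover have "real (card ?S) \<le> d" using F(2) True unfolding bounded_system_def by simp
    ultimately show ?thesis by linarith
  qed (simp add: bad_transition_def d)
qed (use simple_graph_edge[OF G] simple_graph_no_loop[OF G] in \<open>auto simp: insert_commute bad_transition_def\<close>)

text \<open>Incompatible edges share a vertex, and distinct cycle edges that meet are consecutive,
  so \<open>ccycle_nth\<close> covers every relevant pair.\<close>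

lemma hamilton_cycle_of_ccycle:
  assumes T: "transition_system V (\<lambda>x y. {x, y} \<in> E) (bad_transition E F) d"
    and F: "incompatibility_system E F"
    and c: "transition_system.ccycle V (\<lambda>x y. {x, y} \<in> E) (bad_transition E F) c" "set c = V"
  shows "hamilton_cycle V E c \<and> compatible_cycle F c"
proof -
  interpret transition_system V "\<lambda>x y. {x, y} \<in> E" "bad_transition E F" d by (rule T)
  let ?L = "length c"
  have dist: "distinct c" and L: "3 \<le> ?L" using c by (auto simp: ccycle_def)
  have edge: "{c ! i, c ! (Suc i mod ?L)} \<in> E" if "i < ?L" for i using ccycle_nth(1)[OF c(1) that] .
  have comp: "\<not> incompatible F {c ! i, c ! (Suc i mod ?L)} {c ! j, c ! (Suc j mod ?L)}"
    if "i < ?L" "j < ?L" "j = Suc i mod ?L" for i j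
  proof -
    have "Suc j mod ?L = Suc (Suc i) mod ?L" using that(3) by (simp add: mod_Suc_eq)
    then show ?thesis
      using ccycle_nth(2)[OF c(1) that(1)] edge[OF that(1)] edge[OF that(2)] that(3)
      by (simp add: bad_transition_def)
  qed
  have sym: "incompatible F e e' \<Longrightarrow> incompatible F e' e" for e e'
    by (auto simp: incompatible_def insert_commute)
  have "\<not> incompatible F e e'" if ee: "e \<in> cycle_edges c" "e' \<in> cycle_edges c" "e \<noteq> e'" for e e'
  proof
    assume inc: "incompatible F e e'"
    obtain i where i: "i < ?L" "e = {c ! i, c ! (Suc i mod ?L)}"
      using ee(1) by (auto simp: cycle_edges_def)
    obtain j where j: "j < ?L" "e' = {c ! j, c ! (Suc j mod ?L)}"
      using ee(2) by (auto simp: cycle_edges_def)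
    obtain v where v: "{e, e'} \<in> F v" using inc by (auto simp: incompatible_def)
    have ij: "i \<noteq> j" using ee(3) i j by auto
    have m: "Suc i mod ?L < ?L" "Suc j mod ?L < ?L" using L by (auto intro: mod_less_divisor)
    have "Suc i mod ?L \<noteq> Suc j mod ?L" using ij i(1) j(1) by (auto simp: mod_Suc split: if_splits)
    then have "c ! i \<noteq> c ! j" "c ! (Suc i mod ?L) \<noteq> c ! (Suc j mod ?L)"
      using ij i(1) j(1) m dist by (simp_all add: nth_eq_iff_index_eq)
    moreover have "e \<inter> e' \<noteq> {}" using incompatible_at(1)[OF F v] by simp
    \<comment> \<open>Distinct edges have distinct first and distinct second endpoints, so they can
      only meet crosswise.\<close>
    ultimately have "c ! i = c ! (Suc j mod ?L) \<or> c ! j = c ! (Suc i mod ?L)" using i j by auto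
    then have "i = Suc j mod ?L \<or> j = Suc i mod ?L"
      using i(1) j(1) m dist by (simp add: nth_eq_iff_index_eq)
    then show False using comp[of i j] comp[of j i] i j inc sym by blast
  qed
  then have "compatible_cycle F c" by (simp add: compatible_cycle_def)
  moreover have "hamilton_cycle V E c"
    using c(2) dist L edge by (auto simp: hamilton_cycle_def cycle_edges_def)
  ultimately show ?thesis by blast
qed

theorem theorem3p1:
  fixes V :: "'a set" and E :: "'a set set" and F :: "'a \<Rightarrow> 'a set set set"
    and \<mu> :: real and n :: nat
  assumes "\<mu> > 0" and "sqrt \<mu> < 1 / 400"
    and "simple_graph V E" and "card V = n"
    and "\<forall>v\<in>V. real (degree E v) \<ge> real n / 2"
    and "incompatibility_system E F"
    and "bounded_system E F (\<mu> * real n)"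
  shows "(\<exists>cs. hamilton_cycle V E cs \<and> compatible_cycle F cs)
       \<or> (\<exists>A B. A \<subseteq> V \<and> B \<subseteq> V
              \<and> real (card A) \<ge> (1/2 - 200 * sqrt \<mu>) * real n
              \<and> real (card B) \<ge> (1/2 - 200 * sqrt \<mu>) * real n
              \<and> real (e_between E A B) \<le> 16 * sqrt \<mu> * (real n)^2)"
    (is "_ \<or> ?extremal")
proof (cases "n \<ge> 3")
  case True
  let ?adj = "\<lambda>x y. {x, y} \<in> E"
  have sq: "(sqrt \<mu>)\<^sup>2 = \<mu>" using assms(1) by simp
  have T: "transition_system V ?adj (bad_transition E F) ((sqrt \<mu>)\<^sup>2 * real (card V))"
    unfolding sq assms(4) using assms(1) by (intro transition_system_of_graph assms) simp
  show ?thesis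
  proof (cases ?extremal)
    case False
    have "\<exists>c. transition_system.ccycle V ?adj (bad_transition E F) c \<and> set c = V"
    proof (rule compatible_hamilton[OF T])
      show "real (card V) / 2 \<le> real (card {y. {x, y} \<in> E})" if "x \<in> V" for x
        using assms(4,5) degree_eq_card_neighbours[OF assms(3)] that by simp
      show "16 * sqrt \<mu> * (real (card V))\<^sup>2 < real (card {(x, y). x \<in> A \<and> y \<in> B \<and> {x, y} \<in> E})"
        if "A \<subseteq> V" "B \<subseteq> V" "(1/2 - 200 * sqrt \<mu>) * real (card V) \<le> real (card A)"
          "(1/2 - 200 * sqrt \<mu>) * real (card V) \<le> real (card B)" for A B
        using False that assms(4) unfolding e_between_def by (meson not_le)
    qed (use assms True in auto)
    then show ?thesis using hamilton_cycle_of_ccycle[OF T assms(6)] by blast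
  qed blast
next
  case False
  \<comment> \<open>For n <= 2 a single vertex is large enough, as n/2 <= 1, and spans no edge;
    taking it for both sets gives alternative (ii). If V is empty, so is A.\<close>
  define A where "A = (if V = {} then {} else {SOME v. v \<in> V})"
  have A: "A \<subseteq> V" by (auto simp: A_def some_in_eq)
  have cA: "real (card A) \<ge> (1/2 - 200 * sqrt \<mu>) * real n"
  proof (cases "V = {}")
    case False
    have "(1/2 - 200 * sqrt \<mu>) * real n \<le> (1/2) * real n"
      using assms(1) by (intro mult_right_mono) auto
    also have "\<dots> \<le> 1" using \<open>\<not> n \<ge> 3\<close> by simp
    finally show ?thesis using False by (simp add: A_def)
  qed (use assms(4) in \<open>simp add: A_def\<close>)
  have "{(x, y). x \<in> A \<and> y \<in> A \<and> {x, y} \<in> E} = {}"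
    using simple_graph_no_loop[OF assms(3)] by (auto simp: A_def split: if_splits)
  then have "e_between E A A = 0" unfolding e_between_def by (metis card.empty)
  then have "real (e_between E A A) \<le> 16 * sqrt \<mu> * (real n)\<^sup>2" using assms(1) by simp
  then show ?thesis using A cA by blast
qed

end
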